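(* Let $V\colon\mathbb{R}^d\to[0,\infty)$ be a function in $L^\infty_{\rm loc}(\mathbb{R}^d)$. Assume that one of the following three conditions holds: (1) $V(x)\approx 1$ globally; (2) for some $\alpha>0$, $V(x)\approx|x|^\alpha$ globally; (3) for some $\beta>1$, $V(x)\approx\beta^{|x|}$ globally. Then each of the Riesz transforms $R_V^a$, $a>0$, is bounded on $L^\infty(\mathbb{R}^d)$.
   Context: $A\approx B$ globally, for $A,B\colon\mathbb{R}^d\to[0,\infty)$, means that there are a compact set $F\subset\mathbb{R}^d$ and constants $0<c<C$ with $cA(x)\leqslant B(x)\leqslant CA(x)$ for a.e. $x\notin F$. $|\cdot|$ is the Euclidean norm. Let $L=-\frac12\Delta+V$. For $t>0$ and $f\in L^\infty$ (in particular for the constant function $\mathbf 1$) define $e^{-tL}f(x)=\mathbb{E}_x\big[e^{-\int_0^tV(X_s)\,ds}f(X_t)\big]$, where $\mathbb{E}_x$ is expectation for the standard $d$-dimensional Brownian motion $\{X_s\}$ (generator $\frac12\Delta$) started at $x$. For $a>0$ put $$R_V^a(\mathbf 1)(x)=V^a(x)\cdot\frac1{\Gamma(a)}\int_0^\infty e^{-tL}(\mathbf 1)(x)\,t^{a-1}\,dt\in[0,\infty].$$ $R_V^a$ is said to be bounded on $L^\infty$ if $\|R_V^a(\mathbf 1)\|_\infty<\infty$. *)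

theory Defs
  imports "HOL-Probability.Probability"
begin

text \<open>
  Standard Brownian motion in a Euclidean space, started at the origin. Over the standard
  orthonormal basis, the product of one-dimensional normal densities of variance \<open>t - s\<close> is the
  density of \<open>N(0, (t - s) I)\<close>. The generator is thus one half of the Laplacian.
\<close>

locale brownian_motion = prob_space M
  for M :: "'w measure" +
  fixes B :: "real \<Rightarrow> 'w \<Rightarrow> 'a::euclidean_space"
  assumes random_variable_B: "\<And>t. 0 \<le> t \<Longrightarrow> random_variable borel (B t)"
    and start: "AE \<omega> in M. B 0 \<omega> = 0"
    and gaussian_increments:
      "\<And>s t. 0 \<le> s \<Longrightarrow> s < t \<Longrightarrow>
        distributed M lborel (\<lambda>\<omega>. B t \<omega> - B s \<omega>)
          (\<lambda>y. ennreal (\<Prod>b\<in>Basis. normal_density 0 (sqrt (t - s)) (y \<bullet> b)))"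
    and independent_increments:
      "\<And>(n::nat) (t::nat \<Rightarrow> real). 0 \<le> t 0 \<Longrightarrow> (\<And>i. i < n \<Longrightarrow> t i \<le> t (Suc i)) \<Longrightarrow>
        indep_vars (\<lambda>_. borel) (\<lambda>i \<omega>. B (t (Suc i)) \<omega> - B (t i) \<omega>) {..<n}"
    and continuous_paths: "AE \<omega> in M. continuous_on {0..} (\<lambda>t. B t \<omega>)"

text \<open>
  Brownian motion started at \<open>x\<close> is \<open>x + B\<close>. As \<open>V\<close> and \<open>f\<close> are only Lebesgue measurable, the path
  integral is measurable (and its integrand Lebesgue measurable, for almost every path) only up to
  null sets. Hence the time integral is taken with respect to \<open>lebesgue\<close> and the expectation
  with respect to the completion of \<open>M\<close>.
\<close>

definition schroedinger_semigroup ::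
  "'w measure \<Rightarrow> (real \<Rightarrow> 'w \<Rightarrow> 'a) \<Rightarrow> ('a \<Rightarrow> real) \<Rightarrow> real \<Rightarrow> ('a \<Rightarrow> real) \<Rightarrow> 'a::euclidean_space \<Rightarrow> real"
  where "schroedinger_semigroup M B V t f x =
    (LINT \<omega>|completion M. exp (- (LINT s:{0..t}|lebesgue. V (x + B s \<omega>))) * f (x + B t \<omega>))"

definition riesz_one ::
  "'w measure \<Rightarrow> (real \<Rightarrow> 'w \<Rightarrow> 'a) \<Rightarrow> ('a \<Rightarrow> real) \<Rightarrow> real \<Rightarrow> 'a::euclidean_space \<Rightarrow> ennreal"
  where "riesz_one M B V a x =
    ennreal (V x powr a) * (ennreal (1 / Gamma a) *
      (\<integral>\<^sup>+ t\<in>{0<..}. ennreal (schroedinger_semigroup M B V t (\<lambda>_. 1) x * t powr (a - 1)) \<partial>lborel))"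

definition riesz_bounded ::
  "'w measure \<Rightarrow> (real \<Rightarrow> 'w \<Rightarrow> 'a) \<Rightarrow> ('a::euclidean_space \<Rightarrow> real) \<Rightarrow> real \<Rightarrow> bool"
  where "riesz_bounded M B V a \<longleftrightarrow> esssup lebesgue (riesz_one M B V a) < \<infinity>"

definition approx_globally :: "('a::euclidean_space \<Rightarrow> real) \<Rightarrow> ('a \<Rightarrow> real) \<Rightarrow> bool"
  where "approx_globally f g \<longleftrightarrow>
    (\<exists>F c C. compact F \<and> 0 < c \<and> c < C \<and>
      (AE x in lebesgue. x \<notin> F \<longrightarrow> c * f x \<le> g x \<and> g x \<le> C * f x))"

definition Linf_loc :: "('a::euclidean_space \<Rightarrow> real) \<Rightarrow> bool"
  where "Linf_loc f \<longleftrightarrow> f \<in> borel_measurable lebesgue \<and>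
    (\<forall>K. compact K \<longrightarrow> (\<exists>C. AE x in lebesgue. x \<in> K \<longrightarrow> \<bar>f x\<bar> \<le> C))"

end

theory Submission
  imports Defs "HOL-Real_Asymp.Real_Asymp"
begin

text \<open>
  Far from the origin the Riesz transform of \<open>1\<close> should look like the one for a constant potential
  \<open>\<lambda>\<close>, which is \<open>\<lambda>\<^sup>a / \<Gamma>(a) \<integral> e\<^sup>-\<^sup>\<lambda>\<^sup>t t\<^sup>a\<^sup>-\<^sup>1 dt = 1\<close>. To make this precise,
  write \<open>survival x t\<close> for \<open>e\<^sup>-\<^sup>t\<^sup>L 1\<close> at \<open>x\<close>, and let \<open>g\<close> be the model \<open>1\<close>, \<open>|x|\<^sup>\<alpha>\<close> or \<open>\<beta>\<^sup>|\<^sup>x\<^sup>|\<close> for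
  the potential. Two facts about survival are enough (\<open>laplace_bound\<close>, \<open>riesz_integral_bounded\<close>): it
  decays exponentially in \<open>t\<close>, uniformly in \<open>x\<close> (\<open>survival_exp_decay\<close>), and for large \<open>x\<close> it is at most
  \<open>exp (- c g(x) t)\<close> plus an error of order \<open>g(x) powr (- 2 a)\<close> (\<open>rapidly_killed\<close>). The minimum of
  the error and the uniform decay is at most their geometric mean, so it contributes only
  \<open>O(g(x) powr (- a))\<close> to the time integral.

  Both facts come from one application of Jensen's inequality (\<open>survival_le_grid\<close>): as the potential
  enters through a time average inside a convex function, survival up to time \<open>n T\<close> is bounded
  by the expectation of \<open>exp (- T \<Sum> V)\<close>, the sum being taken over \<open>n\<close> positions at distance \<open>T\<close> in time. For
  large \<open>n\<close> these positions form a Gaussian random walk; a large \<open>T\<close> makes each step land, with high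
  probability, where \<open>V\<close> is bounded below, and independence of the increments gives
  geometric decay. For \<open>n = 1\<close> the bound says that a particle is killed at rate at least \<open>m\<close> unless it
  leaves a ball on which \<open>V \<ge> m\<close> (\<open>survival_le_ball\<close>), and Gaussian tails bound the probability of
  the latter. If \<open>V\<close> grows like a power, the ball of radius \<open>|x|/2\<close> works. If \<open>V\<close> grows exponentially, it is
  comparable to its size at \<open>x\<close> only on the unit ball; that ball serves for times up to
  \<open>g(x) powr (- 1/4)\<close>, and for later times the ball of radius \<open>|x|/2\<close>, on which \<open>V\<close> is still at least of order
  \<open>sqrt (g(x))\<close>, already makes survival negligible (\<open>rapidly_killed_exponential_growth\<close>).

  There remain the null sets. A potential that is only Lebesgue measurable is replaced by a Borel
  one that satisfies its bounds everywhere (\<open>borel_potential_exists\<close>), and the Brownian motion by a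
  version with only continuous paths; by Fubini's theorem neither changes the semigroup applied to \<open>1\<close>
  (\<open>schroedinger_semigroup_eq_survival\<close>).
\<close>

section \<open>Exponential bounds, Laplace integrals and time averages\<close>

lemma exp_minus_le_powr:
  fixes c p :: real
  assumes "0 < c" "0 < p"
  obtains D where "0 < D" "\<And>z. 0 < z \<Longrightarrow> exp (- (c * z)) \<le> D * z powr (- p)"
proof
  \<comment> \<open>The maximum of \<open>z powr p * exp (- (c * z))\<close> is attained at \<open>z = p / c\<close>.\<close>
  show "0 < (p / c) powr p" using assms by simp
  fix z :: real assume z: "0 < z"
  have "ln z = ln (p / c) + ln (z * c / p)"
    using z assms by (simp add: ln_mult ln_div)
  also have "\<dots> \<le> ln (p / c) + (z * c / p - 1)"
    using z assms by (intro add_mono order_refl ln_le_minus_one) auto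
  finally have "p * ln z \<le> p * (ln (p / c) + (z * c / p - 1))"
    using assms by (intro mult_left_mono) auto
  also have "\<dots> = p * ln (p / c) + c * z - p"
    using assms by (simp add: field_simps)
  finally have "- (c * z) \<le> p * ln (p / c) + - p * ln z"
    using assms by simp
  then have "exp (- (c * z)) \<le> exp (p * ln (p / c) + - p * ln z)"
    by simp
  also have "\<dots> = (p / c) powr p * z powr (- p)"
    using z assms by (simp add: powr_def exp_add[symmetric])
  finally show "exp (- (c * z)) \<le> (p / c) powr p * z powr (- p)" .
qed

lemma nn_integral_exp_powr:
  fixes a c :: real
  assumes a: "0 < a" and c: "0 < c"
  shows "(\<integral>\<^sup>+ t\<in>{0<..}. ennreal (exp (- (c * t)) * t powr (a - 1)) \<partial>lborel)
    = ennreal (Gamma a / c powr a)"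
proof -
  let ?g = "\<lambda>t. ennreal (indicator {0..} t * t powr (a - 1) / exp t)"
  let ?f = "\<lambda>t. ennreal (exp (- (c * t)) * t powr (a - 1)) * indicator {0<..} t"
  have "ennreal (Gamma a) = ennreal c * (\<integral>\<^sup>+ t. ?g (0 + c * t) \<partial>lborel)"
    using c by (subst Gamma_conv_nn_integral_real[OF a], subst nn_integral_real_affine[of _ c 0]) auto
  also have "(\<integral>\<^sup>+ t. ?g (0 + c * t) \<partial>lborel) = (\<integral>\<^sup>+ t. ennreal (c powr (a - 1)) * ?f t \<partial>lborel)"
  proof (rule nn_integral_cong_AE, use AE_lborel_singleton[of "0::real"] in eventually_elim)
    fix t :: real assume "t \<noteq> 0"
    then show "?g (0 + c * t) = ennreal (c powr (a - 1)) * ?f t"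
      using c by (cases "0 < t")
        (auto simp: indicator_def powr_mult ennreal_mult[symmetric] exp_minus field_simps
          zero_le_mult_iff)
  qed
  also have "\<dots> = ennreal (c powr (a - 1)) * (\<integral>\<^sup>+ t. ?f t \<partial>lborel)"
    by (intro nn_integral_cmult) auto
  finally have "ennreal (Gamma a) = ennreal (c powr a) * (\<integral>\<^sup>+ t. ?f t \<partial>lborel)"
    using c by (simp add: mult.assoc[symmetric] ennreal_mult[symmetric] powr_diff)
  then have "ennreal (1 / c powr a) * ennreal (Gamma a)
      = (ennreal (1 / c powr a) * ennreal (c powr a)) * (\<integral>\<^sup>+ t. ?f t \<partial>lborel)"
    by (simp add: mult.assoc)
  also have "ennreal (1 / c powr a) * ennreal (c powr a) = 1"
    using c by (simp add: ennreal_mult[symmetric])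
  finally show ?thesis
    using c Gamma_real_pos[OF a] by (simp add: ennreal_mult[symmetric])
qed

text \<open>
  How bounds on survival become a bound on the Riesz transform, with \<open>l\<close> standing for the size of
  the potential. The main term integrates to exactly the power of \<open>l\<close> that is needed. The remainder is small in
  \<open>l\<close> but not integrable in \<open>t\<close>, whereas the uniform exponential decay is integrable but not small;
  the minimum of the two is at most their geometric mean, which is both. This is why the remainder is
  required to have order \<open>l powr (- (2 * a))\<close> rather than \<open>l powr (- a)\<close>.
\<close>

lemma laplace_bound:
  fixes \<phi> :: "real \<Rightarrow> real"
  assumes a: "0 < a" and c: "0 < c" and l: "0 < l" and d: "0 < d" and D: "0 \<le> D" and K: "0 \<le> K"
    and short: "\<And>t. 0 < t \<Longrightarrow> \<phi> t \<le> exp (- (c * l * t)) + D * l powr (- (2 * a))"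
    and long: "\<And>t. 0 < t \<Longrightarrow> \<phi> t \<le> K * exp (- (d * t))"
  shows "ennreal (l powr a) * (\<integral>\<^sup>+ t\<in>{0<..}. ennreal (\<phi> t * t powr (a - 1)) \<partial>lborel)
    \<le> ennreal (Gamma a / c powr a + sqrt (D * K) * (Gamma a / (d / 2) powr a))"
proof -
  define A where "A = sqrt (D * K) * l powr (- a)"
  have A: "0 \<le> A" unfolding A_def using D K by simp
  have le: "\<phi> t \<le> exp (- (c * l * t)) + A * exp (- (d / 2 * t))" if t: "0 < t" for t
  proof -
    let ?u = "D * l powr (- (2 * a))" and ?w = "K * exp (- (d * t))"
    have "min ?u ?w \<le> sqrt (?u * ?w)"
      unfolding power2_eq_square
      using D K by (intro real_le_rsqrt) (simp only: power2_eq_square, intro mult_mono, auto)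
    also have "\<dots> = A * exp (- (d / 2 * t))"
    proof (rule real_sqrt_unique)
      have "l powr (- (2 * a)) = l powr (- a) * l powr (- a)"
        by (simp add: powr_add[symmetric])
      moreover have "exp (- (d * t)) = exp (- (d / 2 * t)) * exp (- (d / 2 * t))"
        by (simp add: exp_add[symmetric])
      moreover have "sqrt (D * K) * sqrt (D * K) = D * K" using D K by simp
      ultimately show "(A * exp (- (d / 2 * t)))\<^sup>2 = ?u * ?w"
        unfolding A_def power2_eq_square by (simp only: mult_ac)
          (metis mult.assoc mult.left_commute)
    qed (use A in simp)
    finally have "min ?u ?w \<le> A * exp (- (d / 2 * t))" .
    moreover have "\<phi> t \<le> exp (- (c * l * t)) + min ?u ?w"
      using short[OF t] add_increasing[OF exp_ge_zero long[OF t]] by (auto simp: min_def)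
    ultimately show ?thesis by linarith
  qed
  have "(\<integral>\<^sup>+ t\<in>{0<..}. ennreal (\<phi> t * t powr (a - 1)) \<partial>lborel)
    \<le> (\<integral>\<^sup>+ t. ennreal (exp (- (c * l * t)) * t powr (a - 1)) * indicator {0<..} t
        + ennreal A * (ennreal (exp (- (d / 2 * t)) * t powr (a - 1)) * indicator {0<..} t) \<partial>lborel)"
  proof (rule nn_integral_mono)
    fix t :: real
    show "ennreal (\<phi> t * t powr (a - 1)) * indicator {0<..} t
      \<le> ennreal (exp (- (c * l * t)) * t powr (a - 1)) * indicator {0<..} t
        + ennreal A * (ennreal (exp (- (d / 2 * t)) * t powr (a - 1)) * indicator {0<..} t)"
    proof (cases "0 < t")
      case True
      have "\<phi> t * t powr (a - 1) \<le> (exp (- (c * l * t)) + A * exp (- (d / 2 * t))) * t powr (a - 1)"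
        by (intro mult_right_mono le True) simp
      then show ?thesis using True A
        by (simp add: ennreal_mult[symmetric] ennreal_plus[symmetric] ennreal_leI algebra_simps
            del: ennreal_plus)
    qed simp
  qed
  also have "\<dots> = ennreal (Gamma a / (c * l) powr a) + ennreal A * ennreal (Gamma a / (d / 2) powr a)"
    using c l d
    by (subst nn_integral_add, simp, simp, subst nn_integral_cmult, simp)
      (subst (1 2) nn_integral_exp_powr[OF a], auto)
  also have "\<dots> = ennreal (Gamma a / (c * l) powr a + A * (Gamma a / (d / 2) powr a))"
    using A Gamma_real_pos[OF a] by (simp add: ennreal_mult[symmetric] ennreal_plus[symmetric] del: ennreal_plus)
  finally have "ennreal (l powr a) * (\<integral>\<^sup>+ t\<in>{0<..}. ennreal (\<phi> t * t powr (a - 1)) \<partial>lborel)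
    \<le> ennreal (l powr a) * ennreal (Gamma a / (c * l) powr a + A * (Gamma a / (d / 2) powr a))"
    by (rule mult_left_mono) simp
  also have "\<dots> = ennreal (l powr a * (Gamma a / (c * l) powr a + A * (Gamma a / (d / 2) powr a)))"
    using A Gamma_real_pos[OF a] by (intro ennreal_mult[symmetric]) auto
  also have "l powr a * (Gamma a / (c * l) powr a + A * (Gamma a / (d / 2) powr a))
      = Gamma a / c powr a + sqrt (D * K) * (Gamma a / (d / 2) powr a)"
    using c l by (simp add: A_def powr_mult powr_minus field_simps)
  finally show ?thesis .
qed

lemma ennreal_integral_le:
  fixes f :: "'b \<Rightarrow> real"
  assumes "integrable M f"
  shows "ennreal (\<integral>x. f x \<partial>M) \<le> (\<integral>\<^sup>+ x. ennreal (f x) \<partial>M)"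
proof -
  have "(\<integral>x. f x \<partial>M) \<le> enn2real (\<integral>\<^sup>+ x. ennreal (f x) \<partial>M)"
    using real_lebesgue_integral_def[OF assms] by simp
  then have "ennreal (\<integral>x. f x \<partial>M) \<le> ennreal (enn2real (\<integral>\<^sup>+ x. ennreal (f x) \<partial>M))"
    by (rule ennreal_leI)
  also have "\<dots> \<le> (\<integral>\<^sup>+ x. ennreal (f x) \<partial>M)"
    by (simp add: ennreal_enn2real_if)
  finally show ?thesis .
qed

text \<open>
  Jensen's inequality for the convex function \<open>z \<mapsto> exp (- z)\<close> and uniform measure on \<open>[0, T]\<close>: integrate
  the tangent inequality \<open>exp (- z) \<ge> exp (- m) (1 + m - z)\<close> at the mean \<open>m\<close> of \<open>f\<close>. The right-hand
  side is a nonnegative integral, so that it can be exchanged with an expectation later.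
\<close>

lemma exp_mean_le:
  fixes f :: "real \<Rightarrow> real"
  assumes T: "0 < T" and f: "set_integrable lborel {0..T} f"
  shows "ennreal (T * exp (- ((LINT u:{0..T}|lborel. f u) / T)))
    \<le> (\<integral>\<^sup>+ u\<in>{0..T}. ennreal (exp (- f u)) \<partial>lborel)"
proof -
  define m where "m = (LINT u:{0..T}|lborel. f u) / T"
  have int1: "set_integrable lborel {0..T} (\<lambda>_. c)" for c :: real
    unfolding set_integrable_def by (intro borel_integrable_compact) auto
  let ?h = "\<lambda>u. exp (- m) * (1 + m) - exp (- m) * f u"
  have int2: "set_integrable lborel {0..T} ?h"
    using f by (intro set_integral_diff int1 set_integrable_mult_right) auto
  have "(LINT u:{0..T}|lborel. ?h u)
      = (LINT u:{0..T}|lborel. exp (- m) * (1 + m)) - (LINT u:{0..T}|lborel. exp (- m) * f u)"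
    using f by (intro set_integral_diff int1 set_integrable_mult_right) auto
  also have "\<dots> = T * exp (- m)"
    using T by (simp add: m_def set_lebesgue_integral_def field_simps)
  finally have "ennreal (T * exp (- m)) = ennreal (LINT u:{0..T}|lborel. ?h u)" by simp
  also have "\<dots> \<le> (\<integral>\<^sup>+ u. ennreal (indicator {0..T} u *\<^sub>R ?h u) \<partial>lborel)"
    unfolding set_lebesgue_integral_def using int2[unfolded set_integrable_def]
    by (intro ennreal_integral_le)
  also have "\<dots> \<le> (\<integral>\<^sup>+ u\<in>{0..T}. ennreal (exp (- f u)) \<partial>lborel)"
  proof (rule nn_integral_mono)
    fix u
    have "1 + (m - f u) \<le> exp (m - f u)" by (rule exp_ge_add_one_self)
    then have "exp (- m) * (1 + (m - f u)) \<le> exp (- m) * exp (m - f u)" by simp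
    also have "\<dots> = exp (- f u)" by (simp add: exp_add[symmetric])
    finally have "?h u \<le> exp (- f u)" by (simp add: algebra_simps)
    then show "ennreal (indicator {0..T} u *\<^sub>R ?h u) \<le> ennreal (exp (- f u)) * indicator {0..T} u"
      by (auto simp: indicator_def intro!: ennreal_leI)
  qed
  finally show ?thesis by (simp add: m_def)
qed

lemma set_integral_grid:
  fixes f :: "real \<Rightarrow> real"
  assumes f: "\<And>a b. set_integrable lborel {a..b} f" and T: "0 < T"
  shows "(LINT s:{0..real n * T}|lborel. f s) = (LINT u:{0..T}|lborel. (\<Sum>i<n. f (u + real i * T)))"
    and "set_integrable lborel {0..T} (\<lambda>u. \<Sum>i<n. f (u + real i * T))"
proof -
  have shift: "(LINT u:{0..T}|lborel. f (u + c)) = (LINT s:{c..c + T}|lborel. f s)"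
    "set_integrable lborel {0..T} (\<lambda>u. f (u + c))" for c
  proof -
    have eq: "indicator {c..c + T} (c + 1 * u) *\<^sub>R f (c + 1 * u) = indicator {0..T} u *\<^sub>R f (u + c)" for u
      by (auto simp: indicator_def add.commute)
    show "(LINT u:{0..T}|lborel. f (u + c)) = (LINT s:{c..c + T}|lborel. f s)"
      unfolding set_lebesgue_integral_def
      by (subst lborel_integral_real_affine[of 1 _ c]) (simp_all only: eq, auto)
    show "set_integrable lborel {0..T} (\<lambda>u. f (u + c))"
      using lborel_integrable_real_affine[OF f[of c "c + T", unfolded set_integrable_def], of 1 c]
      unfolding set_integrable_def eq by simp
  qed
  show int: "set_integrable lborel {0..T} (\<lambda>u. \<Sum>i<n. f (u + real i * T))" for n
    unfolding set_integrable_def scaleR_sum_right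
    using shift(2)[unfolded set_integrable_def] by (intro Bochner_Integration.integrable_sum)
  show "(LINT s:{0..real n * T}|lborel. f s) = (LINT u:{0..T}|lborel. (\<Sum>i<n. f (u + real i * T)))"
  proof (induction n)
    case 0
    have "AE s in lborel. indicator {0..0} s *\<^sub>R f s = 0"
      using AE_lborel_singleton[of "0::real"] by eventually_elim (auto simp: indicator_def)
    then show ?case
      unfolding set_lebesgue_integral_def by (simp add: integral_eq_zero_AE)
  next
    case (Suc n)
    have hk: "(LINT s:{a..b}|lborel. f s) = integral {a..b} f" "f integrable_on {a..b}" for a b
      using set_borel_integral_eq_integral[OF f] by auto
    have "(LINT s:{0..real (Suc n) * T}|lborel. f s)
        = (LINT s:{0..real n * T}|lborel. f s) + (LINT s:{real n * T..real n * T + T}|lborel. f s)"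
      unfolding hk using T Henstock_Kurzweil_Integration.integral_combine[where a=0 and c="real n * T" and b="real (Suc n) * T" and f=f] hk(2)
      by (simp add: algebra_simps)
    also have "\<dots> = (LINT u:{0..T}|lborel. (\<Sum>i<n. f (u + real i * T)))
        + (LINT u:{0..T}|lborel. f (u + real n * T))"
      by (simp only: Suc.IH shift(1))
    also have "\<dots> = (LINT u:{0..T}|lborel. (\<Sum>i<Suc n. f (u + real i * T)))"
      unfolding sum.lessThan_Suc by (intro set_integral_add(2)[symmetric] int shift(2))
    finally show ?case .
  qed
qed

section \<open>Estimates for the Gaussian density\<close>

definition heat_kernel :: "real \<Rightarrow> 'a::euclidean_space \<Rightarrow> real"
  where "heat_kernel t y = (\<Prod>b\<in>Basis. normal_density 0 (sqrt t) (y \<bullet> b))"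

lemma borel_measurable_heat_kernel [measurable]: "heat_kernel t \<in> borel_measurable borel"
  unfolding heat_kernel_def[abs_def] by measurable

lemma heat_kernel_nonneg: "0 \<le> heat_kernel t y"
  unfolding heat_kernel_def by (intro prod_nonneg) auto

lemma heat_kernel_le:
  fixes y :: "'a::euclidean_space"
  assumes t: "0 < t"
  shows "heat_kernel t y \<le> (1 / sqrt (2 * pi * t)) ^ DIM('a)"
proof -
  have "normal_density 0 (sqrt t) z \<le> 1 / sqrt (2 * pi * t)" for z
    using t by (auto simp: normal_density_def intro!: divide_right_mono)
  then have "heat_kernel t y \<le> (\<Prod>b\<in>(Basis::'a set). 1 / sqrt (2 * pi * t))"
    unfolding heat_kernel_def by (intro prod_mono) auto
  then show ?thesis by simp
qed

text \<open>
  Completing the square turns \<open>exp (\<plusminus> y / s)\<close> times the centred density into \<open>exp (1/2)\<close> times a density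
  with mean \<open>\<plusminus> s\<close>. Scaling the exponent by \<open>s\<close> is what makes the bound independent of \<open>s\<close>.
\<close>

lemma nn_integral_normal_density_exp_abs:
  assumes s: "0 < s"
  shows "(\<integral>\<^sup>+ y. ennreal (normal_density 0 s y * exp (\<bar>y\<bar> / s)) \<partial>lborel) \<le> ennreal (2 * exp (1/2))"
proof -
  have shift: "normal_density 0 s y * exp (k * y / s) = exp (1/2) * normal_density (k * s) s y"
    if "k = 1 \<or> k = -1" for k y
  proof -
    have "-(y - 0)\<^sup>2 / (2 * s\<^sup>2) + k * y / s = 1/2 + -(y - k * s)\<^sup>2 / (2 * s\<^sup>2)"
      using s that by (auto simp: field_simps power2_eq_square)
    then have "exp (-(y - 0)\<^sup>2 / (2 * s\<^sup>2)) * exp (k * y / s)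
        = exp (1/2) * exp (-(y - k * s)\<^sup>2 / (2 * s\<^sup>2))"
      by (simp only: exp_add[symmetric])
    then show ?thesis by (simp add: normal_density_def)
  qed
  have one: "(\<integral>\<^sup>+ y. ennreal (normal_density m s y) \<partial>lborel) = 1" for m
    using integral_normal_density[OF s, of m] integrable_normal_density[OF s, of m]
    by (subst nn_integral_eq_integral) auto
  have "(\<integral>\<^sup>+ y. ennreal (normal_density 0 s y * exp (\<bar>y\<bar> / s)) \<partial>lborel)
    \<le> (\<integral>\<^sup>+ y. ennreal (exp (1/2)) * ennreal (normal_density (1 * s) s y)
        + ennreal (exp (1/2)) * ennreal (normal_density (- 1 * s) s y) \<partial>lborel)"
  proof (rule nn_integral_mono)
    fix y
    have "exp (\<bar>y\<bar> / s) \<le> exp (1 * y / s) + exp (- 1 * y / s)"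
      by (cases "0 \<le> y") (auto simp: abs_if add_increasing add_increasing2)
    then have "normal_density 0 s y * exp (\<bar>y\<bar> / s)
        \<le> normal_density 0 s y * exp (1 * y / s) + normal_density 0 s y * exp (- 1 * y / s)"
      by (metis distrib_left mult_left_mono normal_density_nonneg)
    also have "\<dots> = exp (1/2) * normal_density (1 * s) s y + exp (1/2) * normal_density (- 1 * s) s y"
      by (subst (1 2) shift) auto
    finally show "ennreal (normal_density 0 s y * exp (\<bar>y\<bar> / s))
        \<le> ennreal (exp (1/2)) * ennreal (normal_density (1 * s) s y)
        + ennreal (exp (1/2)) * ennreal (normal_density (- 1 * s) s y)"
      by (simp add: ennreal_mult[symmetric] ennreal_plus[symmetric] ennreal_leI del: ennreal_plus)
  qed
  also have "\<dots> = ennreal (exp (1/2)) + ennreal (exp (1/2))"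
    by (subst nn_integral_add) (auto simp: nn_integral_cmult one)
  also have "\<dots> = ennreal (2 * exp (1/2))"
    by (simp add: ennreal_plus[symmetric] del: ennreal_plus)
  finally show ?thesis .
qed

text \<open>
  Chernoff's bound. Comparing \<open>norm y\<close> with the sum of its absolute coordinates lets the exponential
  moment factorise over the basis. The decay \<open>exp (- r / sqrt t)\<close> is weaker than Gaussian, but it beats
  every power of \<open>t\<close> as \<open>t \<rightarrow> 0\<close> with \<open>r > 0\<close> fixed, and this suffices.
\<close>

lemma heat_kernel_tail:
  assumes t: "0 < t"
  shows "(\<integral>\<^sup>+ y. ennreal (heat_kernel t y) * indicator {y::'a::euclidean_space. r \<le> norm y} y \<partial>lborel)
    \<le> ennreal ((2 * exp (1/2)) ^ DIM('a) * exp (- (r / sqrt t)))"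
proof -
  let ?s = "sqrt t"
  have s: "0 < ?s" using t by simp
  let ?f = "\<lambda>y. normal_density 0 ?s y * exp (\<bar>y\<bar> / ?s)"
  have "(\<integral>\<^sup>+ y. ennreal (heat_kernel t y) * indicator {y::'a. r \<le> norm y} y \<partial>lborel)
    \<le> (\<integral>\<^sup>+ (y::'a). ennreal (exp (- (r / ?s))) * (\<Prod>b\<in>Basis. ennreal (?f (y \<bullet> b))) \<partial>lborel)"
  proof (rule nn_integral_mono)
    fix y :: 'a
    have "heat_kernel t y * indicator {y. r \<le> norm y} y
        \<le> heat_kernel t y * exp (- (r / ?s) + (\<Sum>b\<in>Basis. \<bar>y \<bullet> b\<bar> / ?s))"
    proof (rule mult_left_mono[OF _ heat_kernel_nonneg])
      have "r \<le> norm y \<Longrightarrow> r / ?s \<le> (\<Sum>b\<in>Basis. \<bar>y \<bullet> b\<bar>) / ?s"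
        using norm_le_l1[of y] s by (intro divide_right_mono) auto
      then show "indicator {y. r \<le> norm y} y \<le> exp (- (r / ?s) + (\<Sum>b\<in>Basis. \<bar>y \<bullet> b\<bar> / ?s))"
        by (auto simp: indicator_def sum_divide_distrib)
    qed
    also have "\<dots> = exp (- (r / ?s)) * (\<Prod>b\<in>Basis. ?f (y \<bullet> b))"
      by (simp only: exp_add exp_sum[OF finite_Basis] heat_kernel_def prod.distrib mult_ac)
    finally show "ennreal (heat_kernel t y) * indicator {y. r \<le> norm y} y
        \<le> ennreal (exp (- (r / ?s))) * (\<Prod>b\<in>Basis. ennreal (?f (y \<bullet> b)))"
      by (subst prod_ennreal)
        (auto simp: ennreal_mult[symmetric] prod_nonneg indicator_def heat_kernel_nonneg
          intro!: ennreal_leI split: if_splits)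
  qed
  also have "\<dots> = ennreal (exp (- (r / ?s))) * (\<Prod>b\<in>(Basis::'a set). \<integral>\<^sup>+ y. ennreal (?f y) \<partial>lborel)"
    by (subst nn_integral_cmult, simp)
      (subst nn_integral_lborel_prod[where f="\<lambda>_ y. ennreal (?f y)"], auto)
  also have "\<dots> \<le> ennreal (exp (- (r / ?s))) * (\<Prod>b\<in>(Basis::'a set). ennreal (2 * exp (1/2)))"
    using nn_integral_normal_density_exp_abs[OF s]
    by (auto intro!: mult_left_mono power_mono)
  also have "\<dots> = ennreal ((2 * exp (1/2)) ^ DIM('a) * exp (- (r / ?s)))"
    by (simp add: ennreal_power ennreal_mult[symmetric] mult.commute)
  finally show ?thesis .
qed

lemma nn_integral_heat_kernel_indicator_le:
  fixes A :: "'a::euclidean_space set"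
  assumes t: "0 < t" and [measurable]: "A \<in> sets borel"
  shows "(\<integral>\<^sup>+ y. ennreal (heat_kernel t y) * indicator A y \<partial>lborel)
    \<le> ennreal ((1 / sqrt (2 * pi * t)) ^ DIM('a)) * emeasure lborel A"
proof -
  have "(\<integral>\<^sup>+ y. ennreal (heat_kernel t y) * indicator A y \<partial>lborel)
    \<le> (\<integral>\<^sup>+ y. ennreal ((1 / sqrt (2 * pi * t)) ^ DIM('a)) * indicator A y \<partial>lborel)"
    by (intro nn_integral_mono mult_right_mono ennreal_leI heat_kernel_le t) auto
  also have "\<dots> = ennreal ((1 / sqrt (2 * pi * t)) ^ DIM('a)) * emeasure lborel A"
    by (intro nn_integral_cmult_indicator) auto
  finally show ?thesis .
qed

text \<open>
  A random walk with independent steps \<open>z j\<close> collects the factor \<open>f i\<close> at its \<open>i\<close>-th position. If every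
  factor has mean at most \<open>q i\<close> from every starting point of the \<open>i\<close>-th step, the last step can be
  integrated out first, and the bounds multiply. This is the form in which the Markov property enters.
\<close>

lemma nn_integral_random_walk_prod_le:
  fixes N :: "nat \<Rightarrow> 'a::euclidean_space measure" and f :: "nat \<Rightarrow> 'a \<Rightarrow> ennreal"
  assumes "\<And>i. prob_space (N i)" and [measurable_cong]: "\<And>i. sets (N i) = sets borel"
    and [measurable]: "\<And>i. f i \<in> borel_measurable borel"
    and le: "\<And>i y. i < n \<Longrightarrow> (\<integral>\<^sup>+ z. f i (y + z) \<partial>N i) \<le> q i"
  shows "(\<integral>\<^sup>+ z. (\<Prod>i<n. f i (x + (\<Sum>j\<le>i. z j))) \<partial>PiM {..<n} N) \<le> (\<Prod>i<n. q i)"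
  using le
proof (induction n)
  case 0
  interpret prob_space "PiM ({}::nat set) N" by (rule prob_space_PiM) (rule assms(1))
  show ?case using emeasure_space_1 by simp
next
  case (Suc n)
  interpret product_prob_space N by (rule product_prob_spaceI) (rule assms(1))
  have "(\<lambda>z. z j) \<in> borel_measurable (PiM {..<m} N)" if "j < m" for j m
    using measurable_component_singleton[of j "{..<m}" N] that assms(2)
    by (simp cong: measurable_cong_sets)
  then have "(\<lambda>z. \<Sum>j\<le>i. z j) \<in> borel_measurable (PiM {..<m} N)" if "i < m" for i m
    using that by (intro borel_measurable_sum) auto
  then have meas: "(\<lambda>z. \<Prod>i<k. f i (x + (\<Sum>j\<le>i. z j))) \<in> borel_measurable (PiM {..<m} N)"
    if "k \<le> m" for k m
    using that by (intro borel_measurable_prod_ennreal measurable_compose[OF _ assms(3)] borel_measurable_add) auto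
  have [measurable]: "(\<lambda>z. \<Prod>i<Suc n. f i (x + (\<Sum>j\<le>i. z j))) \<in> borel_measurable (PiM (insert n {..<n}) N)"
    "(\<lambda>z. \<Prod>i<n. f i (x + (\<Sum>j\<le>i. z j))) \<in> borel_measurable (PiM {..<n} N)"
    using meas[of "Suc n" "Suc n"] meas[of n n] by (simp_all add: lessThan_Suc)
  have "(\<integral>\<^sup>+ z. (\<Prod>i<Suc n. f i (x + (\<Sum>j\<le>i. z j))) \<partial>PiM {..<Suc n} N)
    = (\<integral>\<^sup>+ z. \<integral>\<^sup>+ y. (\<Prod>i<Suc n. f i (x + (\<Sum>j\<le>i. (z(n := y)) j))) \<partial>N n \<partial>PiM {..<n} N)"
    unfolding lessThan_Suc by (subst product_nn_integral_insert) (auto simp flip: lessThan_Suc)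
  also have "\<dots> = (\<integral>\<^sup>+ z. \<integral>\<^sup>+ y. (\<Prod>i<n. f i (x + (\<Sum>j\<le>i. z j))) * f n ((x + (\<Sum>j<n. z j)) + y) \<partial>N n \<partial>PiM {..<n} N)"
  proof (intro nn_integral_cong)
    fix z y
    have "(\<Prod>i<n. f i (x + (\<Sum>j\<le>i. (z(n := y)) j))) = (\<Prod>i<n. f i (x + (\<Sum>j\<le>i. z j)))"
      by (intro prod.cong arg_cong2[where f=f] arg_cong2[where f="(+)"] sum.cong) auto
    moreover have "(\<Sum>j\<le>n. (z(n := y)) j) = (\<Sum>j<n. z j) + y"
      by (simp add: lessThan_Suc_atMost[symmetric])
    ultimately show "(\<Prod>i<Suc n. f i (x + (\<Sum>j\<le>i. (z(n := y)) j)))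
      = (\<Prod>i<n. f i (x + (\<Sum>j\<le>i. z j))) * f n ((x + (\<Sum>j<n. z j)) + y)"
      by (simp add: add.assoc)
  qed
  also have "\<dots> = (\<integral>\<^sup>+ z. (\<Prod>i<n. f i (x + (\<Sum>j\<le>i. z j))) * (\<integral>\<^sup>+ y. f n ((x + (\<Sum>j<n. z j)) + y) \<partial>N n) \<partial>PiM {..<n} N)"
    proof (intro nn_integral_cong nn_integral_cmult)
    fix c :: 'a
    have "(\<lambda>y. f n (c + y)) \<in> borel_measurable borel" by measurable
    then show "(\<lambda>y. f n (c + y)) \<in> borel_measurable (N n)"
      by (subst measurable_cong_sets[OF assms(2) refl])
  qed
  also have "\<dots> \<le> (\<integral>\<^sup>+ z. (\<Prod>i<n. f i (x + (\<Sum>j\<le>i. z j))) * q n \<partial>PiM {..<n} N)"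
    by (intro nn_integral_mono mult_left_mono Suc.prems) auto
  also have "\<dots> = (\<integral>\<^sup>+ z. (\<Prod>i<n. f i (x + (\<Sum>j\<le>i. z j))) \<partial>PiM {..<n} N) * q n"
    by (intro nn_integral_multc) measurable
  also have "\<dots> \<le> (\<Prod>i<n. q i) * q n"
    using Suc.prems by (intro mult_right_mono Suc.IH) auto
  finally show ?case by simp
qed

section \<open>A continuous version of the Brownian motion\<close>

text \<open>
  A process with continuous paths is the pointwise limit of the processes that read it off only at
  the grid points \<open>k / n\<close>, and those are jointly measurable because the grid is countable.
\<close>

lemma borel_measurable_continuous_paths:
  fixes W :: "real \<Rightarrow> 'w \<Rightarrow> 'a::euclidean_space"
  assumes [measurable]: "\<And>t. W t \<in> borel_measurable M"
    and cont: "\<And>\<omega>. continuous_on UNIV (\<lambda>t. W t \<omega>)"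
  shows "(\<lambda>(t, \<omega>). W t \<omega>) \<in> borel_measurable (borel \<Otimes>\<^sub>M M)"
proof (rule borel_measurable_LIMSEQ_metric)
  fix n :: nat
  have "(\<lambda>p. (\<lambda>k p. W (of_int k / real (Suc n)) (snd p)) \<lfloor>fst p * real (Suc n)\<rfloor> p)
      \<in> borel_measurable (borel \<Otimes>\<^sub>M M)"
    by (rule measurable_compose_countable) measurable
  then show "(\<lambda>p. W (of_int \<lfloor>fst p * real (Suc n)\<rfloor> / real (Suc n)) (snd p))
      \<in> borel_measurable (borel \<Otimes>\<^sub>M M)" by simp
next
  fix p :: "real \<times> 'w" assume "p \<in> space (borel \<Otimes>\<^sub>M M)"
  obtain t \<omega> where p: "p = (t, \<omega>)" by (cases p)
  have "(\<lambda>n. of_int \<lfloor>t * real (Suc n)\<rfloor> / real (Suc n)) \<longlonglongrightarrow> t"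
  proof (rule tendsto_sandwich[OF always_eventually always_eventually])
    show "\<forall>n. t - 1 / real (Suc n) \<le> of_int \<lfloor>t * real (Suc n)\<rfloor> / real (Suc n)"
    proof
      fix n
      have "t * real (Suc n) - 1 \<le> of_int \<lfloor>t * real (Suc n)\<rfloor>" by linarith
      then have "(t * real (Suc n) - 1) / real (Suc n) \<le> of_int \<lfloor>t * real (Suc n)\<rfloor> / real (Suc n)"
        by (intro divide_right_mono) auto
      then show "t - 1 / real (Suc n) \<le> of_int \<lfloor>t * real (Suc n)\<rfloor> / real (Suc n)"
        by (simp add: diff_divide_distrib)
    qed
    show "\<forall>n. of_int \<lfloor>t * real (Suc n)\<rfloor> / real (Suc n) \<le> t"
      by (simp add: divide_le_eq)
    have "(\<lambda>n. t - 1 / real (Suc n)) \<longlonglongrightarrow> t - 0"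
      by (intro tendsto_diff tendsto_const LIMSEQ_Suc lim_1_over_n)
    then show "(\<lambda>n. t - 1 / real (Suc n)) \<longlonglongrightarrow> t" by simp
  qed auto
  moreover have "isCont (\<lambda>t. W t \<omega>) t"
    using cont[of \<omega>] by (simp add: continuous_on_eq_continuous_at)
  ultimately show "(\<lambda>n. W (of_int \<lfloor>fst p * real (Suc n)\<rfloor> / real (Suc n)) (snd p))
      \<longlonglongrightarrow> (case p of (t, \<omega>) \<Rightarrow> W t \<omega>)"
    unfolding p prod.case fst_conv snd_conv by (intro isCont_tendsto_compose[where g="\<lambda>t. W t \<omega>"])
qed

lemma (in brownian_motion) continuous_version_exists:
  obtains W where "\<And>t. W t \<in> borel_measurable M" "\<And>\<omega>. continuous_on UNIV (\<lambda>t. W t \<omega>)"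
    "AE \<omega> in M. \<forall>t\<ge>0. W t \<omega> = B t \<omega>"
proof -
  from continuous_paths obtain N where N: "N \<in> null_sets M"
    "{\<omega> \<in> space M. \<not> continuous_on {0..} (\<lambda>t. B t \<omega>)} \<subseteq> N"
    unfolding eventually_ae_filter by auto
  define W where "W t \<omega> = (if \<omega> \<in> space M - N then B (max 0 t) \<omega> else 0)" for t \<omega>
  show thesis
  proof
    have [measurable]: "N \<in> sets M" using N by auto
    have [measurable]: "B (max 0 t) \<in> borel_measurable M" for t
      by (rule random_variable_B) simp
    show "W t \<in> borel_measurable M" for t
      unfolding W_def[abs_def] by measurable
    show "continuous_on UNIV (\<lambda>t. W t \<omega>)" for \<omega>
    proof (cases "\<omega> \<in> space M - N")
      case True
      then have "continuous_on {0..} (\<lambda>t. B t \<omega>)" using N by auto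
      then have "continuous_on UNIV (\<lambda>t. B (max 0 t) \<omega>)"
        by (rule continuous_on_compose2) (auto intro!: continuous_intros)
      then show ?thesis using True by (simp add: W_def)
    next
      case False
      then have "W t \<omega> = 0" for t by (auto simp: W_def)
      then show ?thesis by simp
    qed
    show "AE \<omega> in M. \<forall>t\<ge>0. W t \<omega> = B t \<omega>"
      using AE_not_in[OF N(1)] AE_space by eventually_elim (simp add: W_def)
  qed
qed

text \<open>
  The process \<open>B\<close> has continuous paths only almost surely, and at negative times it is arbitrary. With
  \<open>W\<close> the exceptional paths are gone, so every path integral below is defined for every \<open>\<omega>\<close>, while all
  laws are still those of \<open>B\<close>.
\<close>

locale continuous_brownian_version = brownian_motion M B
  for M :: "'w measure" and B :: "real \<Rightarrow> 'w \<Rightarrow> 'a::euclidean_space" +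
  fixes W :: "real \<Rightarrow> 'w \<Rightarrow> 'a"
  assumes W_measurable [measurable]: "\<And>t. W t \<in> borel_measurable M"
    and W_continuous: "\<And>\<omega>. continuous_on UNIV (\<lambda>t. W t \<omega>)"
    and W_eq_B: "AE \<omega> in M. \<forall>t\<ge>0. W t \<omega> = B t \<omega>"
begin

lemma W_jointly_measurable [measurable]:
  "(\<lambda>(t, \<omega>). W t \<omega>) \<in> borel_measurable (borel \<Otimes>\<^sub>M M)"
  by (rule borel_measurable_continuous_paths[OF W_measurable W_continuous])

lemma nn_integral_increment:
  assumes s: "0 \<le> s" "s < t" and [measurable]: "g \<in> borel_measurable borel"
  shows "(\<integral>\<^sup>+ \<omega>. g (B t \<omega> - B s \<omega>) \<partial>M)
    = (\<integral>\<^sup>+ y. ennreal (heat_kernel (t - s) y) * g y \<partial>lborel)"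
  using distributed_nn_integral[OF gaussian_increments[OF s], of g] by (simp add: heat_kernel_def)

lemma nn_integral_W:
  assumes t: "0 < t" and [measurable]: "g \<in> borel_measurable borel"
  shows "(\<integral>\<^sup>+ \<omega>. g (W t \<omega>) \<partial>M) = (\<integral>\<^sup>+ y. ennreal (heat_kernel t y) * g y \<partial>lborel)"
proof -
  have "(\<integral>\<^sup>+ \<omega>. g (W t \<omega>) \<partial>M) = (\<integral>\<^sup>+ \<omega>. g (B t \<omega> - B 0 \<omega>) \<partial>M)"
    using W_eq_B start t by (intro nn_integral_cong_AE) (auto elim!: eventually_elim2)
  then show ?thesis using nn_integral_increment[of 0 t g] t by simp
qed

text \<open>
  At each positive time the law of \<open>W s\<close> has a density, so the expected time spent in a Lebesgue
  null set is zero. Hence a potential may be changed on a null set without changing its path integrals.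
\<close>

lemma AE_W_notin_null_set:
  assumes N: "N \<in> null_sets lborel"
  shows "AE \<omega> in M. AE s in lborel. 0 < s \<longrightarrow> x + W s \<omega> \<notin> N"
proof -
  have [measurable]: "N \<in> sets borel" using N by auto
  interpret P: pair_sigma_finite lborel M ..
  have "(\<integral>\<^sup>+ \<omega>. \<integral>\<^sup>+ s. indicator ({0<..}) s * indicator N (x + W s \<omega>) \<partial>lborel \<partial>M)
    = (\<integral>\<^sup>+ s. \<integral>\<^sup>+ \<omega>. indicator ({0<..}) s * indicator N (x + W s \<omega>) \<partial>M \<partial>lborel)"
    by (intro P.Fubini') measurable
  also have "\<dots> = (\<integral>\<^sup>+ s. 0 \<partial>(lborel :: real measure))"
  proof (rule nn_integral_cong)
    fix s :: real
    show "(\<integral>\<^sup>+ \<omega>. indicator ({0<..}) s * indicator N (x + W s \<omega>) \<partial>M) = 0"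
    proof (cases "0 < s")
      case True
      have N': "{y. y + x \<in> N} \<in> null_sets lborel"
        using null_sets_translation[OF N, of "- x"] by simp
      have "(\<integral>\<^sup>+ \<omega>. indicator N (x + W s \<omega>) \<partial>M)
          = (\<integral>\<^sup>+ y. ennreal (heat_kernel s y) * indicator N (x + y) \<partial>lborel)"
        using nn_integral_W[OF True, of "\<lambda>y. indicator N (x + y)"] by simp
      also have "\<dots> = (\<integral>\<^sup>+ (y::'a). 0 \<partial>lborel)"
      proof (rule nn_integral_cong_AE)
        from AE_not_in[OF N'] show "AE y in lborel. ennreal (heat_kernel s y) * indicator N (x + y) = 0"
          by eventually_elim (auto simp: indicator_def add.commute)
      qed
      finally show ?thesis using True by simp
    qed simp
  qed
  finally have "(\<integral>\<^sup>+ \<omega>. \<integral>\<^sup>+ s. indicator ({0<..}) s * indicator N (x + W s \<omega>) \<partial>lborel \<partial>M) = 0"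
    by simp
  then have "AE \<omega> in M. (\<integral>\<^sup>+ s. indicator ({0<..}) s * indicator N (x + W s \<omega>) \<partial>lborel) = 0"
    by (subst (asm) nn_integral_0_iff_AE) auto
  with AE_space show ?thesis
  proof eventually_elim
    fix \<omega> assume [measurable]: "\<omega> \<in> space M"
    assume "(\<integral>\<^sup>+ s. indicator ({0<..}) s * indicator N (x + W s \<omega>) \<partial>lborel) = 0"
    then have "AE s in lborel. indicator ({0<..}) s * indicator N (x + W s \<omega>) = (0::ennreal)"
      by (subst (asm) nn_integral_0_iff_AE) auto
    then show "AE s in lborel. 0 < s \<longrightarrow> x + W s \<omega> \<notin> N"
      by eventually_elim (auto simp: indicator_def)
  qed
qed

text \<open>
  The positions at times \<open>u + T\<close>, \<open>u + 2 T\<close>, and so on, form a random walk with Gaussian steps, started at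
  the random point \<open>x + W u\<close>. The step from \<open>0\<close> to \<open>u\<close> carries the trivial factor \<open>1\<close>, because it may
  be arbitrarily short and then has no smallness to offer.
\<close>

lemma nn_integral_grid_prod_le:
  assumes u: "0 < u" and T: "0 < T" and [measurable]: "f \<in> borel_measurable borel"
    and q: "\<And>y. (\<integral>\<^sup>+ z. ennreal (heat_kernel T z) * f (y + z) \<partial>lborel) \<le> q"
  shows "(\<integral>\<^sup>+ \<omega>. (\<Prod>i<n. f (x + W (u + real (Suc i) * T) \<omega>)) \<partial>M) \<le> q ^ n"
proof -
  define t where "t i = (case i of 0 \<Rightarrow> 0 | Suc j \<Rightarrow> u + real j * T)" for i
  define Y where "Y i \<omega> = B (t (Suc i)) \<omega> - B (t i) \<omega>" for i \<omega>
  define f' where "f' i = (case i of 0 \<Rightarrow> (\<lambda>_. 1) | Suc _ \<Rightarrow> f)" for i :: nat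
  define q' where "q' i = (case i of 0 \<Rightarrow> 1 | Suc _ \<Rightarrow> q)" for i :: nat
  have t0: "0 \<le> t i" for i using u T by (auto simp: t_def split: nat.split)
  have t_less: "t i < t (Suc i)" for i
    using u T by (auto simp: t_def algebra_simps split: nat.split)
  have [measurable]: "B (t i) \<in> borel_measurable M" for i by (rule random_variable_B[OF t0])
  have Y[measurable]: "Y i \<in> borel_measurable M" for i unfolding Y_def[abs_def] by measurable
  have f'[measurable]: "f' i \<in> borel_measurable borel" for i by (auto simp: f'_def split: nat.split)
  have "indep_vars (\<lambda>_. borel) Y {..<Suc n}"
    unfolding Y_def using t_less by (intro independent_increments) (auto simp: less_imp_le t0)
  then have distr: "distr M (\<Pi>\<^sub>M i\<in>{..<Suc n}. borel) (\<lambda>\<omega>. \<lambda>i\<in>{..<Suc n}. Y i \<omega>)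
      = (\<Pi>\<^sub>M i\<in>{..<Suc n}. distr M borel (Y i))"
    by (subst (asm) indep_vars_iff_distr_eq_PiM) auto
  have path: "AE \<omega> in M. \<forall>i. x + W (u + real i * T) \<omega> = x + (\<Sum>j\<le>i. Y j \<omega>)"
    using W_eq_B start
  proof eventually_elim
    fix \<omega> assume *: "\<forall>t\<ge>0. W t \<omega> = B t \<omega>" "B 0 \<omega> = 0"
    have "(\<Sum>j\<le>i. Y j \<omega>) = B (t (Suc i)) \<omega> - B (t 0) \<omega>" for i
      unfolding Y_def lessThan_Suc_atMost[symmetric] by (rule sum_lessThan_telescope)
    then show "\<forall>i. x + W (u + real i * T) \<omega> = x + (\<Sum>j\<le>i. Y j \<omega>)"
      using * u T by (simp add: t_def)
  qed
  have "(\<integral>\<^sup>+ \<omega>. (\<Prod>i<n. f (x + W (u + real (Suc i) * T) \<omega>)) \<partial>M)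
      = (\<integral>\<^sup>+ \<omega>. (\<Prod>i<Suc n. f' i (x + (\<Sum>j\<le>i. Y j \<omega>))) \<partial>M)"
    using path
  proof (intro nn_integral_cong_AE, eventually_elim)
    fix \<omega> assume *: "\<forall>i. x + W (u + real i * T) \<omega> = x + (\<Sum>j\<le>i. Y j \<omega>)"
    have "(\<Prod>i<Suc n. f' i (x + (\<Sum>j\<le>i. Y j \<omega>))) = (\<Prod>i<n. f (x + (\<Sum>j\<le>Suc i. Y j \<omega>)))"
      by (subst prod.lessThan_Suc_shift) (simp add: f'_def)
    then show "(\<Prod>i<n. f (x + W (u + real (Suc i) * T) \<omega>)) = (\<Prod>i<Suc n. f' i (x + (\<Sum>j\<le>i. Y j \<omega>)))"
      using * by (simp only: )
  qed
  also have "\<dots> = (\<integral>\<^sup>+ \<omega>. (\<Prod>i<Suc n. f' i (x + (\<Sum>j\<le>i. (\<lambda>i\<in>{..<Suc n}. Y i \<omega>) j))) \<partial>M)"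
    by (intro nn_integral_cong prod.cong arg_cong2[where f=f'] arg_cong2[where f="(+)"] sum.cong) auto
  also have "\<dots> = (\<integral>\<^sup>+ z. (\<Prod>i<Suc n. f' i (x + (\<Sum>j\<le>i. z j)))
      \<partial>distr M (\<Pi>\<^sub>M i\<in>{..<Suc n}. borel) (\<lambda>\<omega>. \<lambda>i\<in>{..<Suc n}. Y i \<omega>))"
    by (subst nn_integral_distr) measurable
  also have "\<dots> \<le> (\<Prod>i<Suc n. q' i)"
    unfolding distr
  proof (rule nn_integral_random_walk_prod_le)
    show "prob_space (distr M borel (Y i))" for i by (rule prob_space_distr[OF Y])
    fix i y
    show "(\<integral>\<^sup>+ z. f' i (y + z) \<partial>distr M borel (Y i)) \<le> q' i"
    proof (cases i)
      case 0
      then show ?thesis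
        using prob_space.emeasure_space_1[OF prob_space_distr[OF Y[of i]]] by (simp add: f'_def q'_def)
    next
      case (Suc j)
      have "(\<integral>\<^sup>+ z. f (y + z) \<partial>distr M borel (Y i)) = (\<integral>\<^sup>+ \<omega>. f (y + Y i \<omega>) \<partial>M)"
        by (subst nn_integral_distr) auto
      also have "\<dots> = (\<integral>\<^sup>+ z. ennreal (heat_kernel (t (Suc i) - t i) z) * f (y + z) \<partial>lborel)"
        unfolding Y_def by (subst nn_integral_increment[OF t0 t_less, of "\<lambda>z. f (y + z)"]) auto
      also have "t (Suc i) - t i = T" by (simp add: t_def Suc algebra_simps)
      finally show ?thesis using q by (simp add: f'_def q'_def Suc)
    qed
  qed auto
  also have "\<dots> = q ^ n"
    by (subst prod.lessThan_Suc_shift) (simp add: q'_def)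
  finally show ?thesis .
qed

end

section \<open>Survival of a killed Brownian motion\<close>

locale killed_brownian_motion = continuous_brownian_version M B W
  for M :: "'w measure" and B W :: "real \<Rightarrow> 'w \<Rightarrow> 'a::euclidean_space" +
  fixes V :: "'a \<Rightarrow> real"
  assumes V_measurable [measurable]: "V \<in> borel_measurable borel"
    and V_nonneg: "\<And>x. 0 \<le> V x"
    and V_locally_bounded: "\<And>r. \<exists>C. \<forall>x. norm x \<le> r \<longrightarrow> V x \<le> C"
begin

text \<open>
  The probability of being alive at time \<open>t\<close> when started at \<open>x\<close> and killed at rate \<open>V\<close>. It
  is the semigroup \<open>e\<^sup>-\<^sup>t\<^sup>L\<close> applied to \<open>1\<close>, for a potential that is Borel and bounded on balls;
  therefore no path integral takes the default value of a divergent one.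
\<close>

definition survival :: "'a \<Rightarrow> real \<Rightarrow> real"
  where "survival x t = expectation (\<lambda>\<omega>. exp (- (LINT s:{0..t}|lborel. V (x + W s \<omega>))))"

lemma W_path_measurable [measurable]: "(\<lambda>s. W s \<omega>) \<in> borel_measurable borel"
  by (rule borel_measurable_continuous_onI[OF W_continuous])

lemma path_integrable: "set_integrable lborel {a..b} (\<lambda>s. V (x + W s \<omega>))"
proof -
  have "bounded ((\<lambda>s. x + W s \<omega>) ` {a..b})"
    by (intro compact_imp_bounded compact_continuous_image continuous_intros
        continuous_on_subset[OF W_continuous]) auto
  then obtain r where "\<forall>y\<in>(\<lambda>s. x + W s \<omega>) ` {a..b}. norm y \<le> r"
    unfolding bounded_iff by blast
  then have r: "norm (x + W s \<omega>) \<le> r" if "s \<in> {a..b}" for s using that by auto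
  obtain C where C: "\<And>y. norm y \<le> r \<Longrightarrow> V y \<le> C" using V_locally_bounded by blast
  show ?thesis unfolding set_integrable_def
  proof (rule Bochner_Integration.integrable_bound)
    have "emeasure lborel {a..b} < \<infinity>"
      by (meson emeasure_lborel_cbox_finite emeasure_compact_finite compact_Icc)
    then show "integrable lborel (\<lambda>s. C * indicator {a..b} s :: real)"
      by (intro integrable_mult_right integrable_real_indicator) auto
    show "AE s in lborel. norm (indicator {a..b} s *\<^sub>R V (x + W s \<omega>)) \<le> norm (C * indicator {a..b} s :: real)"
    proof (intro AE_I2)
      fix s show "norm (indicator {a..b} s *\<^sub>R V (x + W s \<omega>)) \<le> norm (C * indicator {a..b} s :: real)"
        using C[OF r[of s]] V_nonneg[of "x + W s \<omega>"] by (auto simp: indicator_def)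
    qed
  qed measurable
qed

lemma path_integral_nonneg: "0 \<le> (LINT s:{a..b}|lborel. V (x + W s \<omega>))"
  unfolding set_lebesgue_integral_def by (intro integral_nonneg_AE AE_I2) (auto simp: V_nonneg)

lemma path_integral_measurable:
  "(\<lambda>(p, \<omega>). LINT s:{0..snd p}|lborel. V (fst p + W s \<omega>)) \<in> borel_measurable ((borel \<Otimes>\<^sub>M borel) \<Otimes>\<^sub>M M)"
proof -
  have "(\<lambda>(q, s). indicator {s. 0 \<le> s \<and> s \<le> snd (fst q)} s *\<^sub>R V (fst (fst q) + W s (snd q)))
      \<in> borel_measurable (((borel \<Otimes>\<^sub>M borel) \<Otimes>\<^sub>M M) \<Otimes>\<^sub>M lborel)"
    unfolding indicator_def mem_Collect_eq case_prod_beta by measurable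
  from lborel.borel_measurable_lebesgue_integral[OF this]
  show ?thesis
    by (simp add: set_lebesgue_integral_def case_prod_beta atLeastAtMost_def atLeast_def atMost_def Int_def)
qed

lemma path_integral_measurable_path [measurable]:
  "(\<lambda>\<omega>. LINT s:{0..t}|lborel. V (x + W s \<omega>)) \<in> borel_measurable M"
  using measurable_compose[OF measurable_Pair1' path_integral_measurable, of "(x, t)"]
  by (simp add: space_pair_measure)

lemma survival_measurable [measurable]:
  "(\<lambda>(x, t). survival x t) \<in> borel_measurable (borel \<Otimes>\<^sub>M borel)"
proof -
  have "(\<lambda>(p, \<omega>). exp (- (LINT s:{0..snd p}|lborel. V (fst p + W s \<omega>))))
      \<in> borel_measurable ((borel \<Otimes>\<^sub>M borel) \<Otimes>\<^sub>M M)"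
    using path_integral_measurable unfolding case_prod_beta by measurable
  from borel_measurable_lebesgue_integral[OF this] show ?thesis
    unfolding survival_def case_prod_beta .
qed

lemma survival_integrable: "integrable M (\<lambda>\<omega>. exp (- (LINT s:{0..t}|lborel. V (x + W s \<omega>))))"
  by (rule integrable_const_bound[where B=1]) (auto simp: path_integral_nonneg)

lemma ennreal_survival:
  "ennreal (survival x t) = (\<integral>\<^sup>+ \<omega>. ennreal (exp (- (LINT s:{0..t}|lborel. V (x + W s \<omega>)))) \<partial>M)"
  unfolding survival_def by (intro nn_integral_eq_integral[symmetric] survival_integrable) auto

lemma survival_nonneg: "0 \<le> survival x t"
  unfolding survival_def by (intro integral_nonneg_AE) auto

lemma survival_le_1: "survival x t \<le> 1"
proof -
  have "survival x t \<le> expectation (\<lambda>_. 1)"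
    unfolding survival_def by (intro integral_mono survival_integrable) (auto simp: path_integral_nonneg)
  then show ?thesis by (simp add: prob_space)
qed

lemma survival_antimono:
  assumes "s \<le> t" shows "survival x t \<le> survival x s"
  unfolding survival_def
proof (intro integral_mono survival_integrable)
  fix \<omega>
  have "(LINT r:{0..s}|lborel. V (x + W r \<omega>)) \<le> (LINT r:{0..t}|lborel. V (x + W r \<omega>))"
    using assms unfolding set_lebesgue_integral_def
    by (intro integral_mono path_integrable[unfolded set_integrable_def])
      (auto simp: V_nonneg indicator_def)
  then show "exp (- (LINT r:{0..t}|lborel. V (x + W r \<omega>))) \<le> exp (- (LINT r:{0..s}|lborel. V (x + W r \<omega>)))"
    by simp
qed

text \<open>
  The integral of \<open>V\<close> over \<open>[0, n T]\<close> is the mean over \<open>u\<close> in \<open>[0, T]\<close> of \<open>T\<close> times the sum of the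
  values at \<open>u, u + T, \<dots>, u + (n - 1) T\<close>. Jensen's inequality pulls that mean out of the exponential, so
  survival is controlled by the positions at finitely many times.
\<close>

lemma survival_le_grid:
  assumes T: "0 < T" and K: "0 \<le> K"
    and le: "\<And>u. 0 < u \<Longrightarrow> u \<le> T \<Longrightarrow>
      (\<integral>\<^sup>+ \<omega>. ennreal (exp (- (T * (\<Sum>i<n. V (x + W (u + real i * T) \<omega>))))) \<partial>M) \<le> ennreal K"
  shows "survival x (real n * T) \<le> K"
proof -
  interpret P: pair_sigma_finite lborel M ..
  let ?z = "\<lambda>u \<omega>. T * (\<Sum>i<n. V (x + W (u + real i * T) \<omega>))"
  have jensen: "ennreal (T * exp (- (LINT s:{0..real n * T}|lborel. V (x + W s \<omega>))))
      \<le> (\<integral>\<^sup>+ u\<in>{0..T}. ennreal (exp (- ?z u \<omega>)) \<partial>lborel)" for \<omega>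
  proof -
    note grid = set_integral_grid[where f="\<lambda>s. V (x + W s \<omega>)" and n=n, OF path_integrable T]
    have "(LINT u:{0..T}|lborel. ?z u \<omega>) / T = (LINT s:{0..real n * T}|lborel. V (x + W s \<omega>))"
      unfolding grid(1) using T by (simp add: set_integral_mult_right)
    moreover have "set_integrable lborel {0..T} (\<lambda>u. ?z u \<omega>)"
      by (intro set_integrable_mult_right grid(2))
    ultimately show ?thesis using exp_mean_le[OF T, of "\<lambda>u. ?z u \<omega>"] by simp
  qed
  have "ennreal T * ennreal (survival x (real n * T))
      = (\<integral>\<^sup>+ \<omega>. ennreal (T * exp (- (LINT s:{0..real n * T}|lborel. V (x + W s \<omega>)))) \<partial>M)"
    using T by (simp add: ennreal_survival ennreal_mult nn_integral_cmult)
  also have "\<dots> \<le> (\<integral>\<^sup>+ \<omega>. (\<integral>\<^sup>+ u\<in>{0..T}. ennreal (exp (- ?z u \<omega>)) \<partial>lborel) \<partial>M)"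
    by (intro nn_integral_mono jensen)
  also have "\<dots> = (\<integral>\<^sup>+ u. \<integral>\<^sup>+ \<omega>. ennreal (exp (- ?z u \<omega>)) * indicator {0..T} u \<partial>M \<partial>lborel)"
    by (intro P.Fubini') measurable
  also have "\<dots> \<le> (\<integral>\<^sup>+ u. ennreal K * indicator {0..T} u \<partial>lborel)"
  proof (rule nn_integral_mono_AE, use AE_lborel_singleton[of "0::real"] in eventually_elim)
    fix u :: real assume "u \<noteq> 0"
    then show "(\<integral>\<^sup>+ \<omega>. ennreal (exp (- ?z u \<omega>)) * indicator {0..T} u \<partial>M) \<le> ennreal K * indicator {0..T} u"
      using le[of u] by (auto simp: indicator_def)
  qed
  also have "\<dots> = ennreal T * ennreal K"
    using T by (simp add: nn_integral_cmult_indicator mult.commute)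
  finally have "ennreal (T * survival x (real n * T)) \<le> ennreal (T * K)"
    using T K by (simp add: ennreal_mult survival_nonneg)
  then show ?thesis using T K by (simp add: survival_nonneg)
qed

text \<open>
  The case of a single grid point: at a time \<open>u \<le> t\<close> the particle either is in the ball, where \<open>V \<ge> m\<close>,
  or has travelled a distance of at least \<open>r\<close>.
\<close>

lemma survival_le_ball:
  assumes t: "0 < t" and r: "0 \<le> r" and m: "\<And>y. norm (y - x) \<le> r \<Longrightarrow> m \<le> V y"
  shows "survival x t \<le> exp (- (m * t)) + (2 * exp (1/2)) ^ DIM('a) * exp (- (r / sqrt t))"
proof -
  let ?C = "(2 * exp (1/2)) ^ DIM('a) :: real"
  have "survival x (real 1 * t) \<le> exp (- (m * t)) + ?C * exp (- (r / sqrt t))"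
  proof (rule survival_le_grid[OF t])
    fix u assume u: "0 < u" "u \<le> t"
    have "(\<integral>\<^sup>+ \<omega>. ennreal (exp (- (t * (\<Sum>i<1. V (x + W (u + real i * t) \<omega>))))) \<partial>M)
        \<le> (\<integral>\<^sup>+ \<omega>. ennreal (exp (- (m * t))) + indicator {y. r \<le> norm y} (W u \<omega>) \<partial>M)"
    proof (rule nn_integral_mono)
      fix \<omega>
      have "exp (- (t * V (x + W u \<omega>))) \<le> exp (- (m * t)) + indicator {y. r \<le> norm y} (W u \<omega>)"
      proof (cases "r \<le> norm (W u \<omega>)")
        case True
        have "exp (- (t * V (x + W u \<omega>))) \<le> 1" using V_nonneg t by simp
        then show ?thesis using True by (simp add: add_increasing)
      next
        case False
        then have "t * m \<le> t * V (x + W u \<omega>)" using m[of "x + W u \<omega>"] t by simp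
        then show ?thesis using False by (simp add: mult.commute)
      qed
      then show "ennreal (exp (- (t * (\<Sum>i<1. V (x + W (u + real i * t) \<omega>)))))
          \<le> ennreal (exp (- (m * t))) + indicator {y. r \<le> norm y} (W u \<omega>)"
        by (cases "r \<le> norm (W u \<omega>)")
          (simp_all add: ennreal_plus[symmetric] ennreal_1[symmetric] ennreal_leI del: ennreal_plus ennreal_1)
    qed
    also have "\<dots> = ennreal (exp (- (m * t))) + (\<integral>\<^sup>+ \<omega>. indicator {y. r \<le> norm y} (W u \<omega>) \<partial>M)"
      by (subst nn_integral_add) (auto simp: emeasure_space_1)
    also have "(\<integral>\<^sup>+ \<omega>. indicator {y. r \<le> norm y} (W u \<omega>) \<partial>M)
        = (\<integral>\<^sup>+ y. ennreal (heat_kernel u y) * indicator {y::'a. r \<le> norm y} y \<partial>lborel)"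
      by (rule nn_integral_W[OF u(1)]) measurable
    also have "\<dots> \<le> ennreal (?C * exp (- (r / sqrt u)))"
      by (rule heat_kernel_tail[OF u(1)])
    also have "\<dots> \<le> ennreal (?C * exp (- (r / sqrt t)))"
      using u r by (intro ennreal_leI mult_left_mono) (auto intro!: divide_left_mono)
    finally show "(\<integral>\<^sup>+ \<omega>. ennreal (exp (- (t * (\<Sum>i<1. V (x + W (u + real i * t) \<omega>))))) \<partial>M)
        \<le> ennreal (exp (- (m * t)) + ?C * exp (- (r / sqrt t)))"
      by (simp add: add_left_mono)
  qed simp
  then show ?thesis by simp
qed

text \<open>
  Choose the grid width \<open>T\<close> so large that the Gaussian step hits the ball of radius \<open>R\<close> with
  probability at most \<open>1/4\<close>, wherever it starts, and that a point outside it costs a factor of at most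
  \<open>1/4\<close>. Then each step halves the survival probability, uniformly in the starting point.
\<close>

lemma survival_exp_decay:
  assumes c: "0 < c" and R: "\<And>y. R \<le> norm y \<Longrightarrow> c \<le> V y"
  obtains d where "0 < d" "\<And>x t. 0 < t \<Longrightarrow> survival x t \<le> 4 * exp (- (d * t))"
proof -
  define v where "v = unit_ball_vol (real DIM('a)) * \<bar>R\<bar> ^ DIM('a)"
  have v: "0 \<le> v" unfolding v_def by simp
  have "((\<lambda>T::real. (1 / sqrt (2 * pi * T)) ^ DIM('a) * v) \<longlongrightarrow> 0 ^ DIM('a) * v) at_top"
    by (intro tendsto_intros) real_asymp
  then have "eventually (\<lambda>T::real. (1 / sqrt (2 * pi * T)) ^ DIM('a) * v < 1/4) at_top"
    by (rule order_tendstoD) (simp add: zero_power)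
  moreover have "((\<lambda>T::real. exp (- (c * T))) \<longlongrightarrow> 0) at_top"
    using c by real_asymp
  then have "eventually (\<lambda>T::real. exp (- (c * T)) < 1/4) at_top"
    by (rule order_tendstoD) simp
  moreover have "eventually (\<lambda>T::real. 0 < T) at_top" by (rule eventually_gt_at_top)
  ultimately have "eventually (\<lambda>T::real. 0 < T \<and> exp (- (c * T)) < 1/4
      \<and> (1 / sqrt (2 * pi * T)) ^ DIM('a) * v < 1/4) at_top"
    by eventually_elim auto
  then obtain T :: real where T: "0 < T" and T1: "exp (- (c * T)) < 1/4"
    and T2: "(1 / sqrt (2 * pi * T)) ^ DIM('a) * v < 1/4"
    using eventually_happens'[OF trivial_limit_at_top_linorder] by blast
  have [measurable]: "cball y r \<in> sets borel" for y :: 'a and r by simp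
  have step: "(\<integral>\<^sup>+ z. ennreal (heat_kernel T z) * ennreal (exp (- (T * V (y + z)))) \<partial>lborel) \<le> ennreal (1/2)"
    for y :: 'a
  proof -
    have "(\<integral>\<^sup>+ z. ennreal (heat_kernel T z) * ennreal (exp (- (T * V (y + z)))) \<partial>lborel)
        \<le> (\<integral>\<^sup>+ z. ennreal (heat_kernel T z) * ennreal (1/4)
          + ennreal (heat_kernel T z) * indicator (cball (- y) \<bar>R\<bar>) z \<partial>lborel)"
    proof (rule nn_integral_mono)
      fix z
      have "ennreal (exp (- (T * V (y + z)))) \<le> ennreal (1/4) + indicator (cball (- y) \<bar>R\<bar>) z"
      proof (cases "R \<le> norm (y + z)")
        case True
        then have "T * c \<le> T * V (y + z)" using R T by simp
        then have "exp (- (T * V (y + z))) \<le> exp (- (c * T))" by (simp add: mult.commute)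
        then have "ennreal (exp (- (T * V (y + z)))) \<le> ennreal (1/4)"
          using T1 by (intro ennreal_leI) linarith
        then show ?thesis by (simp add: add_increasing2)
      next
        case False
        have "dist (- y) z = norm (y + z)"
          by (simp add: dist_norm norm_minus_commute add.commute)
        then have "z \<in> cball (- y) \<bar>R\<bar>" using False by auto
        moreover have "ennreal (exp (- (T * V (y + z)))) \<le> 1"
          using V_nonneg T by (simp add: ennreal_1[symmetric] ennreal_leI del: ennreal_1)
        ultimately show ?thesis by (simp add: add_increasing)
      qed
      then show "ennreal (heat_kernel T z) * ennreal (exp (- (T * V (y + z))))
          \<le> ennreal (heat_kernel T z) * ennreal (1/4) + ennreal (heat_kernel T z) * indicator (cball (- y) \<bar>R\<bar>) z"
        by (metis distrib_left mult_left_mono zero_le)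
    qed
    also have "\<dots> = (\<integral>\<^sup>+ z. ennreal (heat_kernel T z) * ennreal (1/4) \<partial>(lborel::'a measure))
        + (\<integral>\<^sup>+ z. ennreal (heat_kernel T z) * indicator (cball (- y) \<bar>R\<bar>) z \<partial>lborel)"
      by (rule nn_integral_add) measurable
    also have "(\<integral>\<^sup>+ z. ennreal (heat_kernel T z) * ennreal (1/4) \<partial>(lborel::'a measure)) = ennreal (1/4)"
      using nn_integral_W[OF T, of "\<lambda>_. ennreal (1/4)"] by (simp add: emeasure_space_1)
    also have "(\<integral>\<^sup>+ z. ennreal (heat_kernel T z) * indicator (cball (- y) \<bar>R\<bar>) z \<partial>lborel)
        \<le> ennreal ((1 / sqrt (2 * pi * T)) ^ DIM('a)) * emeasure lborel (cball (- y) \<bar>R\<bar>)"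
      by (rule nn_integral_heat_kernel_indicator_le[OF T]) simp
    also have "\<dots> = ennreal ((1 / sqrt (2 * pi * T)) ^ DIM('a) * v)"
      using v T by (simp add: emeasure_cball v_def ennreal_mult)
    also have "\<dots> \<le> ennreal (1/4)"
      using T2 by (intro ennreal_leI) simp
    finally show ?thesis
      by (simp add: add_left_mono ennreal_plus[symmetric] del: ennreal_plus)
  qed
  have decay: "survival x (real (Suc n) * T) \<le> (1/2) ^ n" for x n
  proof (rule survival_le_grid[OF T])
    fix u :: real assume u: "0 < u"
    have "(\<integral>\<^sup>+ \<omega>. ennreal (exp (- (T * (\<Sum>i<Suc n. V (x + W (u + real i * T) \<omega>))))) \<partial>M)
        \<le> (\<integral>\<^sup>+ \<omega>. (\<Prod>i<n. ennreal (exp (- (T * V (x + W (u + real (Suc i) * T) \<omega>))))) \<partial>M)"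
    proof (rule nn_integral_mono)
      fix \<omega>
      have "T * (\<Sum>i<n. V (x + W (u + real (Suc i) * T) \<omega>))
          \<le> T * (\<Sum>i<Suc n. V (x + W (u + real i * T) \<omega>))"
        using T V_nonneg by (subst sum.lessThan_Suc_shift) (simp add: mult_left_mono)
      then have "exp (- (T * (\<Sum>i<Suc n. V (x + W (u + real i * T) \<omega>))))
          \<le> exp (\<Sum>i<n. - (T * V (x + W (u + real (Suc i) * T) \<omega>)))"
        by (simp add: sum_distrib_left sum_negf)
      also have "\<dots> = (\<Prod>i<n. exp (- (T * V (x + W (u + real (Suc i) * T) \<omega>))))"
        by (rule exp_sum) simp
      finally show "ennreal (exp (- (T * (\<Sum>i<Suc n. V (x + W (u + real i * T) \<omega>)))))
          \<le> (\<Prod>i<n. ennreal (exp (- (T * V (x + W (u + real (Suc i) * T) \<omega>)))))"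
        by (subst prod_ennreal) (auto intro: ennreal_leI)
    qed
    also have "\<dots> \<le> ennreal (1/2) ^ n"
      by (rule nn_integral_grid_prod_le[where f="\<lambda>z. ennreal (exp (- (T * V z)))", OF u T _ step]) measurable
    also have "\<dots> = ennreal ((1/2) ^ n)" by (rule ennreal_power) simp
    finally show "(\<integral>\<^sup>+ \<omega>. ennreal (exp (- (T * (\<Sum>i<Suc n. V (x + W (u + real i * T) \<omega>))))) \<partial>M)
        \<le> ennreal ((1/2) ^ n)" .
  qed simp
  show thesis
  proof
    show "0 < ln 2 / T" using T by simp
    fix x t assume t: "0 < (t::real)"
    define n where "n = nat \<lfloor>t / T\<rfloor>"
    have n: "real n * T \<le> t" "t < (real n + 1) * T"
    proof -
      have "real n = of_int \<lfloor>t / T\<rfloor>" using t T by (simp add: n_def)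
      then have "real n \<le> t / T" "t / T < real n + 1" by linarith+
      then show "real n * T \<le> t" "t < (real n + 1) * T" using T by (simp_all add: field_simps)
    qed
    \<comment> \<open>One of the \<open>n\<close> grid points is not used, which costs a factor of \<open>2\<close>; rounding \<open>t\<close> down to a
      multiple of \<open>T\<close> costs another one.\<close>
    have "survival x t \<le> 2 * (1/2) ^ n"
    proof (cases n)
      case 0
      then show ?thesis using survival_le_1[of x t] by simp
    next
      case (Suc k)
      then show ?thesis using order_trans[OF survival_antimono[OF n(1)] decay[of x k, folded Suc]] by simp
    qed
    also have "\<dots> = 4 * exp (- (ln 2 * (real n + 1)))"
    proof -
      have "exp (- (ln 2 * (real n + 1))) = 1 / 2 powr real (n + 1)"
        by (simp add: powr_def exp_minus inverse_eq_divide mult.commute add.commute)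
      also have "\<dots> = (1/2) ^ (n + 1)"
        by (subst powr_realpow) (simp_all add: power_one_over)
      finally have "exp (- (ln 2 * (real n + 1))) = (1/2 :: real) ^ (n + 1)" .
      then show ?thesis by simp
    qed
    also have "\<dots> \<le> 4 * exp (- (ln 2 / T * t))"
    proof -
      have "ln 2 * (t / T) \<le> ln 2 * (real n + 1)"
        using n(2) T by (intro mult_left_mono) (auto simp: field_simps)
      then show ?thesis by simp
    qed
    finally show "survival x t \<le> 4 * exp (- (ln 2 / T * t))" .
  qed
qed

end

section \<open>Passing from Lebesgue to Borel measurable potentials\<close>

lemma measurable_completion_AE_cong:
  fixes f g :: "'b \<Rightarrow> 'c::topological_space"
  assumes g: "g \<in> borel_measurable M" and ae: "AE x in M. f x = g x"
  shows "f \<in> borel_measurable (completion M)"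
proof (rule measurableI)
  fix A :: "'c set" assume A: "A \<in> sets borel"
  show "f -` A \<inter> space (completion M) \<in> sets (completion M)"
  proof (rule completion.in_sets_AE)
    show "g -` A \<inter> space (completion M) \<in> sets (completion M)"
      using measurable_sets[OF measurable_completion[OF g] A] .
    show "AE x in completion M. (x \<in> g -` A \<inter> space (completion M)) = (x \<in> f -` A \<inter> space (completion M))"
      using AE_completion[OF ae] by eventually_elim auto
  qed auto
qed auto

lemma integral_completion_AE_cong:
  fixes f g :: "'b \<Rightarrow> real"
  assumes g: "g \<in> borel_measurable M" and ae: "AE x in M. f x = g x"
  shows "integral\<^sup>L (completion M) f = integral\<^sup>L M g"
proof -
  have "integral\<^sup>L (completion M) f = integral\<^sup>L (completion M) g"
    by (intro integral_cong_AE measurable_completion_AE_cong[OF g ae] measurable_completion[OF g]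
        AE_completion[OF ae])
  then show ?thesis by (simp only: integral_completion[OF g])
qed

text \<open>
  All hypotheses on \<open>V\<close> hold only almost everywhere, whereas a single path may well visit a null set. On
  a Borel null set that contains all the exceptions \<open>V\<close> is replaced by a multiple of \<open>g\<close>, which makes
  the growth condition and the local bounds hold everywhere.
\<close>

lemma borel_potential_exists:
  fixes V g :: "'a::euclidean_space \<Rightarrow> real"
  assumes V: "\<And>x. 0 \<le> V x" "Linf_loc V"
    and g: "continuous_on UNIV g" "\<And>x. 0 \<le> g x"
    and approx: "approx_globally V g"
  obtains U c C R where "U \<in> borel_measurable borel" "\<And>x. 0 \<le> U x"
    "\<And>r. \<exists>K. \<forall>x. norm x \<le> r \<longrightarrow> U x \<le> K" "AE x in lebesgue. V x = U x"
    "0 < c" "0 < C" "\<And>x. R \<le> norm x \<Longrightarrow> c * g x \<le> U x \<and> U x \<le> C * g x"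
proof -
  from approx obtain F c C where F: "compact F" and c: "0 < c" "c < C"
    and Vg: "AE x in lebesgue. x \<notin> F \<longrightarrow> c * V x \<le> g x \<and> g x \<le> C * V x"
    unfolding approx_globally_def by blast
  from V(2) have V_meas: "V \<in> borel_measurable lebesgue"
    and "\<forall>n::nat. \<exists>C. AE x in lebesgue. x \<in> cball 0 (real n) \<longrightarrow> \<bar>V x\<bar> \<le> C"
    unfolding Linf_loc_def using compact_cball by blast+
  then obtain b where b: "\<And>n::nat. AE x in lebesgue. x \<in> cball 0 (real n) \<longrightarrow> \<bar>V x\<bar> \<le> b n" by metis
  from completion_ex_borel_measurable_real[OF V_meas] obtain V0
    where [measurable]: "V0 \<in> borel_measurable borel" and V0: "AE x in lborel. V x = V0 x" by auto
  define P where "P x \<longleftrightarrow> V x = V0 x \<and> (x \<notin> F \<longrightarrow> c * V x \<le> g x \<and> g x \<le> C * V x)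
      \<and> (\<forall>n::nat. x \<in> cball 0 (real n) \<longrightarrow> \<bar>V x\<bar> \<le> b n)" for x
  have "AE x in lborel. P x"
    unfolding P_def using V0 Vg[unfolded AE_completion_iff] b[unfolded AE_completion_iff]
    by (simp add: AE_all_countable)
  then obtain N where N: "N \<in> null_sets lborel" and "\<And>x. x \<notin> N \<Longrightarrow> P x"
    unfolding eventually_ae_filter by auto
  note good = this(2)[unfolded P_def]
  from compact_imp_bounded[OF F] obtain R0 where R0: "\<And>x. x \<in> F \<Longrightarrow> norm x \<le> R0"
    unfolding bounded_iff by blast
  \<comment> \<open>As \<open>1 / C < 1 / c\<close>, the value \<open>g x / C\<close> satisfies both of the growth bounds.\<close>
  define U where "U x = (if x \<in> N then g x / C else V0 x)" for x
  show thesis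
  proof
    have [measurable]: "N \<in> sets borel" "g \<in> borel_measurable borel"
      using N borel_measurable_continuous_onI[OF g(1)] by auto
    show "U \<in> borel_measurable borel" unfolding U_def[abs_def] by measurable
    show "0 \<le> U x" for x
      using g(2)[of x] V(1)[of x] good[of x] c by (auto simp: U_def)
    show "\<exists>K. \<forall>x. norm x \<le> r \<longrightarrow> U x \<le> K" for r
    proof -
      obtain n :: nat where n: "r \<le> real n" using real_arch_simple by blast
      have "bounded (g ` cball 0 r)"
        by (intro compact_imp_bounded compact_continuous_image continuous_on_subset[OF g(1)]) auto
      then obtain G where "\<forall>y\<in>g ` cball 0 r. norm y \<le> G" unfolding bounded_iff by blast
      then have G: "g x \<le> G" if "norm x \<le> r" for x using that by (auto simp: abs_le_iff)
      have "U x \<le> max (b n) (G / C)" if x: "norm x \<le> r" for x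
      proof (cases "x \<in> N")
        case True
        have "g x / C \<le> G / C" using G[OF x] c by (intro divide_right_mono) auto
        then show ?thesis using True by (simp add: U_def le_max_iff_disj)
      next
        case False
        have "x \<in> cball 0 (real n)" using x n by simp
        then have "\<bar>V x\<bar> \<le> b n" "V x = V0 x" using good[OF False] by blast+
        then show ?thesis using False by (auto simp: U_def le_max_iff_disj)
      qed
      then show ?thesis by blast
    qed
    have "AE x in lborel. V x = U x"
      using AE_not_in[OF N] by eventually_elim (simp add: U_def good)
    then show "AE x in lebesgue. V x = U x" by (rule AE_completion)
    show "0 < 1 / C" "0 < 1 / c" using c by auto
    fix x :: 'a assume "R0 + 1 \<le> norm x"
    then have "x \<notin> F" using R0[of x] by auto
    have "g x / C \<le> g x / c" using c g(2)[of x] by (intro divide_left_mono) auto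
    then show "1 / C * g x \<le> U x \<and> U x \<le> 1 / c * g x"
      using good[of x] \<open>x \<notin> F\<close> c by (auto simp: U_def field_simps)
  qed
qed

context killed_brownian_motion
begin

lemma schroedinger_semigroup_eq_survival:
  assumes UV: "AE x in lebesgue. U x = V x"
  shows "schroedinger_semigroup M B U t (\<lambda>_. 1) x = survival x t"
proof -
  from UV[unfolded AE_completion_iff] obtain N where N: "N \<in> null_sets lborel"
    and eq: "\<And>y. y \<notin> N \<Longrightarrow> U y = V y" unfolding eventually_ae_filter by auto
  have "AE \<omega> in M. (LINT s:{0..t}|lebesgue. U (x + B s \<omega>)) = (LINT s:{0..t}|lborel. V (x + W s \<omega>))"
    using W_eq_B AE_W_notin_null_set[OF N, of x]
  proof eventually_elim
    fix \<omega> assume \<omega>: "\<forall>t\<ge>0. W t \<omega> = B t \<omega>" "AE s in lborel. 0 < s \<longrightarrow> x + W s \<omega> \<notin> N"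
    have ae: "AE s in lborel. indicator {0..t} s *\<^sub>R U (x + B s \<omega>) = indicator {0..t} s *\<^sub>R V (x + W s \<omega>)"
      using \<omega>(2) AE_lborel_singleton[of "0::real"]
      by eventually_elim (use \<omega>(1) eq in \<open>auto simp: indicator_def\<close>)
    show "(LINT s:{0..t}|lebesgue. U (x + B s \<omega>)) = (LINT s:{0..t}|lborel. V (x + W s \<omega>))"
      unfolding set_lebesgue_integral_def by (rule integral_completion_AE_cong[OF _ ae]) measurable
  qed
  then have "AE \<omega> in M. exp (- (LINT s:{0..t}|lebesgue. U (x + B s \<omega>))) * 1
      = exp (- (LINT s:{0..t}|lborel. V (x + W s \<omega>)))"
    by eventually_elim simp
  then show ?thesis
    unfolding schroedinger_semigroup_def survival_def
    by (rule integral_completion_AE_cong[rotated]) measurable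
qed

text \<open>
  The essential supremum of a function that is not measurable is \<open>\<infinity>\<close>, hence the joint measurability
  of survival in the starting point and the time enters here.
\<close>

lemma riesz_boundedI:
  assumes U: "U \<in> borel_measurable lebesgue" and UV: "AE x in lebesgue. U x = V x"
    and K: "\<And>x. ennreal (V x powr a) * (\<integral>\<^sup>+ t\<in>{0<..}. ennreal (survival x t * t powr (a - 1)) \<partial>lborel) \<le> ennreal K"
  shows "riesz_bounded M B U a"
proof -
  let ?I = "\<lambda>x. \<integral>\<^sup>+ t\<in>{0<..}. ennreal (survival x t * t powr (a - 1)) \<partial>lborel"
  have riesz: "riesz_one M B U a = (\<lambda>x. ennreal (U x powr a) * (ennreal (1 / Gamma a) * ?I x))"
    unfolding riesz_one_def schroedinger_semigroup_eq_survival[OF UV] ..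
  have "?I \<in> borel_measurable borel" by measurable
  then have "?I \<in> borel_measurable lebesgue" by (simp add: measurable_completion)
  then have "riesz_one M B U a \<in> borel_measurable lebesgue"
    unfolding riesz using U by measurable
  moreover have "AE x in lebesgue. riesz_one M B U a x \<le> ennreal (1 / Gamma a) * ennreal K"
    using UV
  proof eventually_elim
    fix x assume "U x = V x"
    then have "riesz_one M B U a x = ennreal (1 / Gamma a) * (ennreal (V x powr a) * ?I x)"
      unfolding riesz by (simp add: mult.left_commute)
    also have "\<dots> \<le> ennreal (1 / Gamma a) * ennreal K" by (intro mult_left_mono K) simp
    finally show "riesz_one M B U a x \<le> ennreal (1 / Gamma a) * ennreal K" .
  qed
  ultimately have "esssup lebesgue (riesz_one M B U a) \<le> ennreal (1 / Gamma a) * ennreal K"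
    by (rule esssup_I)
  also have "\<dots> < \<infinity>" by (simp add: ennreal_mult_less_top)
  finally show ?thesis unfolding riesz_bounded_def .
qed

section \<open>Rapid killing for potentials of controlled growth\<close>

text \<open>
  Outside a ball \<open>laplace_bound\<close> applies with \<open>l = g x\<close>. Inside it \<open>V\<close> is bounded, and the exponential
  decay alone is enough, which is the same lemma for \<open>l = 1\<close>.
\<close>

lemma riesz_integral_bounded:
  assumes a: "0 < a" and c: "0 < c" and C: "0 < C" and D: "0 \<le> D" and d: "0 < d"
    and g: "\<And>x. R \<le> norm x \<Longrightarrow> 0 < g x" "\<And>x. R \<le> norm x \<Longrightarrow> V x \<le> C * g x"
    and short: "\<And>x t. R \<le> norm x \<Longrightarrow> 0 < t \<Longrightarrow>
      survival x t \<le> exp (- (c * g x * t)) + D * g x powr (- (2 * a))"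
    and long: "\<And>x t. 0 < t \<Longrightarrow> survival x t \<le> 4 * exp (- (d * t))"
  obtains K where "\<And>x. ennreal (V x powr a) *
    (\<integral>\<^sup>+ t\<in>{0<..}. ennreal (survival x t * t powr (a - 1)) \<partial>lborel) \<le> ennreal K"
proof -
  let ?I = "\<lambda>x. \<integral>\<^sup>+ t\<in>{0<..}. ennreal (survival x t * t powr (a - 1)) \<partial>lborel"
  define K1 where "K1 = Gamma a / c powr a + sqrt (D * 4) * (Gamma a / (d / 2) powr a)"
  define K2 where "K2 = Gamma a / 1 powr a + sqrt (1 * 4) * (Gamma a / (d / 2) powr a)"
  have K: "0 \<le> K1" "0 \<le> K2"
    using Gamma_real_pos[OF a] D unfolding K1_def K2_def by auto
  obtain C0 where C0: "\<And>x. norm x \<le> R \<Longrightarrow> V x \<le> C0" using V_locally_bounded by blast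
  show thesis
  proof
    fix x
    show "ennreal (V x powr a) * ?I x \<le> ennreal (max (C powr a * K1) (\<bar>C0\<bar> powr a * K2))"
    proof (cases "R \<le> norm x")
      case True
      have "V x powr a \<le> (C * g x) powr a"
        using g[OF True] V_nonneg a by (intro powr_mono2) auto
      then have "ennreal (V x powr a) * ?I x \<le> ennreal (C powr a) * (ennreal (g x powr a) * ?I x)"
        using C g(1)[OF True]
        by (simp add: mult.assoc[symmetric] ennreal_mult[symmetric] powr_mult[symmetric] mult_right_mono ennreal_leI)
      also have "\<dots> \<le> ennreal (C powr a) * ennreal K1"
        unfolding K1_def using True d D
        by (intro mult_left_mono laplace_bound a c g(1) short long) auto
      also have "\<dots> \<le> ennreal (max (C powr a * K1) (\<bar>C0\<bar> powr a * K2))"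
        using K by (simp add: ennreal_mult[symmetric] ennreal_leI)
      finally show ?thesis .
    next
      case False
      then have "V x powr a \<le> \<bar>C0\<bar> powr a"
        using C0[of x] V_nonneg[of x] a by (intro powr_mono2) auto
      moreover have "?I x \<le> ennreal K2"
      proof -
        have "survival x t \<le> exp (- (1 * 1 * t)) + 1 * 1 powr (- (2 * a))" for t
          using survival_le_1[of x t] by (simp add: add_increasing)
        from laplace_bound[OF a _ _ d _ _ this long[of _ x]] show ?thesis
          by (simp add: K2_def)
      qed
      ultimately have "ennreal (V x powr a) * ?I x \<le> ennreal (\<bar>C0\<bar> powr a) * ennreal K2"
        by (intro mult_mono ennreal_leI) auto
      also have "\<dots> \<le> ennreal (max (C powr a * K1) (\<bar>C0\<bar> powr a * K2))"
        using K by (simp add: ennreal_mult[symmetric] ennreal_leI)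
      finally show ?thesis .
    qed
  qed
qed

text \<open>
  Survival up to a time \<open>t \<le> h\<close> is estimated in a ball of radius \<open>r\<close>, so small that \<open>V\<close>
  has the order of \<open>V x\<close> there. Later times are reduced to \<open>h\<close> by monotonicity and may use a larger ball, of
  radius \<open>\<rho>\<close>: a bound \<open>\<mu>\<close> much smaller than \<open>m\<close> is enough as soon as \<open>\<mu> * h\<close> is large.
\<close>

lemma survival_le_two_scales:
  assumes h: "0 < h" and t: "0 < t" and r: "0 \<le> r" "0 \<le> \<rho>"
    and m: "\<And>y. norm (y - x) \<le> r \<Longrightarrow> m \<le> V y"
    and \<mu>: "\<And>y. norm (y - x) \<le> \<rho> \<Longrightarrow> \<mu> \<le> V y"
  shows "survival x t \<le> exp (- (m * t)) + (exp (- (\<mu> * h)) + (2 * exp (1/2)) ^ DIM('a) *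
    (exp (- (r / sqrt h)) + exp (- (\<rho> / sqrt h))))"
proof (cases "t \<le> h")
  case True
  then have "(2 * exp (1/2)) ^ DIM('a) * exp (- (r / sqrt t)) \<le> (2 * exp (1/2)) ^ DIM('a) * exp (- (r / sqrt h))"
    using t r by (intro mult_left_mono) (auto intro!: divide_left_mono)
  moreover have "0 \<le> (2 * exp (1/2) :: real) ^ DIM('a) * exp (- (\<rho> / sqrt h))" by simp
  ultimately show ?thesis
    using survival_le_ball[OF t r(1), of x m, OF m] exp_ge_zero[of "- (\<mu> * h)"]
    unfolding distrib_left by linarith
next
  case False
  then have "survival x t \<le> survival x h" by (intro survival_antimono) simp
  moreover have "0 \<le> (2 * exp (1/2) :: real) ^ DIM('a) * exp (- (r / sqrt h))" by simp
  ultimately show ?thesis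
    using survival_le_ball[OF h r(2), of x \<mu>, OF \<mu>] exp_ge_zero[of "- (m * t)"]
    unfolding distrib_left by linarith
qed

text \<open>
  Survival far out is as if \<open>V\<close> were constant and equal to a multiple of \<open>g x\<close>, up to an error that is
  polynomially small in \<open>g x\<close> uniformly in time.
\<close>

definition rapidly_killed :: "('a \<Rightarrow> real) \<Rightarrow> real \<Rightarrow> bool"
  where "rapidly_killed g p \<longleftrightarrow> (\<exists>c>0. \<exists>D\<ge>0. \<exists>R. \<forall>x t. R \<le> norm x \<longrightarrow> 0 < t \<longrightarrow>
    survival x t \<le> exp (- (c * g x * t)) + D * g x powr (- p))"

lemma rapidly_killedI:
  assumes "0 < c" "0 \<le> D"
    and "\<And>x t. R \<le> norm x \<Longrightarrow> 0 < t \<Longrightarrow> survival x t \<le> exp (- (c * g x * t)) + D * g x powr (- p)"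
  shows "rapidly_killed g p"
  unfolding rapidly_killed_def using assms by blast

lemma rapidly_killed_bounded_growth: "rapidly_killed (\<lambda>_. 1) p"
proof (rule rapidly_killedI)
  show "survival x t \<le> exp (- (1 * 1 * t)) + 1 * 1 powr (- p)" for x t
    using survival_le_1[of x t] by (simp add: add_increasing)
qed auto

text \<open>
  On the ball of radius \<open>norm x / 2\<close> about \<open>x\<close> the lower bound keeps its order of magnitude, so
  both scales use this ball, with \<open>h = 1\<close>. Leaving it in unit time has a probability exponentially
  small in \<open>norm x\<close>.
\<close>

lemma rapidly_killed_power_growth:
  assumes p: "0 < p" and c: "0 < c" and \<alpha>: "0 < \<alpha>" and R: "1 \<le> R"
    and V: "\<And>x. R \<le> norm x \<Longrightarrow> c * norm x powr \<alpha> \<le> V x"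
  shows "rapidly_killed (\<lambda>x. norm x powr \<alpha>) p"
proof -
  let ?C = "(2 * exp (1/2)) ^ DIM('a) :: real"
  define c' where "c' = c / 2 powr \<alpha>"
  have c': "0 < c'" using c by (simp add: c'_def)
  obtain D1 where D1: "0 < D1" "\<And>z. 0 < z \<Longrightarrow> exp (- (c' * z)) \<le> D1 * z powr (- p)"
    using exp_minus_le_powr[OF c' p] by blast
  have "0 < \<alpha> * p" using \<alpha> p by simp
  then obtain D2 where D2: "0 < D2" "\<And>z. 0 < z \<Longrightarrow> exp (- (1/2 * z)) \<le> D2 * z powr (- (\<alpha> * p))"
    using exp_minus_le_powr[of "1/2" "\<alpha> * p"] by auto
  show ?thesis
  proof (rule rapidly_killedI)
    show "0 < c'" by (rule c')
    show "0 \<le> D1 + ?C * (D2 + D2)" using D1 D2 by simp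
    fix x :: 'a and t :: real assume x: "2 * R \<le> norm x" and t: "0 < t"
    let ?l = "norm x powr \<alpha>"
    have pos: "0 < norm x" using x R by linarith
    have low: "c' * ?l \<le> V y" if y: "norm (y - x) \<le> norm x / 2" for y
    proof -
      have "norm x \<le> norm y + norm (y - x)" by (metis norm_minus_commute norm_triangle_sub)
      then have ny: "norm x / 2 \<le> norm y" using y by simp
      then have "(norm x / 2) powr \<alpha> \<le> norm y powr \<alpha>" using \<alpha> by (intro powr_mono2) auto
      then have "c * (norm x / 2) powr \<alpha> \<le> c * norm y powr \<alpha>" using c by simp
      also have "\<dots> \<le> V y" using ny x by (intro V) simp
      finally show ?thesis by (simp add: c'_def powr_divide)
    qed
    have "survival x t \<le> exp (- (c' * ?l * t)) + (exp (- (c' * ?l * 1)) + ?C *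
        (exp (- ((norm x / 2) / sqrt 1)) + exp (- ((norm x / 2) / sqrt 1))))"
      by (rule survival_le_two_scales[OF _ t _ _ low low]) auto
    also have "\<dots> \<le> exp (- (c' * ?l * t)) + (D1 * ?l powr (- p) + ?C *
        (D2 * norm x powr (- (\<alpha> * p)) + D2 * norm x powr (- (\<alpha> * p))))"
      using D1(2)[of ?l] D2(2)[OF pos] pos by (intro add_mono mult_left_mono order_refl) auto
    also have "norm x powr (- (\<alpha> * p)) = ?l powr (- p)" by (simp add: powr_powr)
    finally show "survival x t \<le> exp (- (c' * ?l * t)) + (D1 + ?C * (D2 + D2)) * ?l powr (- p)"
      by (simp add: algebra_simps)
  qed
qed

text \<open>
  Now the lower bound keeps its order of magnitude only on balls of bounded radius, here \<open>1\<close>, and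
  leaving such a ball is unlikely only for small times. On the ball of radius \<open>norm x / 2\<close> the
  potential is still at least of order \<open>l powr (1/2)\<close>, where \<open>l = \<beta> powr norm x\<close>. The time
  \<open>h = l powr (- (1/4))\<close> lies between the two regimes: it is so short that leaving the unit ball before \<open>h\<close> has
  probability of order \<open>exp (- (l powr (1/8)))\<close>, and so long that staying in the large ball up to \<open>h\<close>
  costs a factor of order \<open>exp (- (c * l powr (1/4)))\<close>.
\<close>

lemma rapidly_killed_exponential_growth:
  assumes p: "0 < p" and c: "0 < c" and \<beta>: "1 < \<beta>" and R: "1 \<le> R"
    and V: "\<And>x. R \<le> norm x \<Longrightarrow> c * \<beta> powr norm x \<le> V x"
  shows "rapidly_killed (\<lambda>x. \<beta> powr norm x) p"
proof -
  let ?C = "(2 * exp (1/2)) ^ DIM('a) :: real"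
  \<comment> \<open>The exponents undo the powers \<open>1/4\<close> and \<open>1/8\<close> of \<open>\<beta> powr norm x\<close> that occur below.\<close>
  have "0 < 4 * p" "0 < 8 * p" using p by auto
  obtain D1 where D1: "0 < D1" "\<And>z. 0 < z \<Longrightarrow> exp (- (c * z)) \<le> D1 * z powr (- (4 * p))"
    using exp_minus_le_powr[OF c \<open>0 < 4 * p\<close>] by blast
  obtain D2 where D2: "0 < D2" "\<And>z. 0 < z \<Longrightarrow> exp (- (1 * z)) \<le> D2 * z powr (- (8 * p))"
    using exp_minus_le_powr[OF zero_less_one \<open>0 < 8 * p\<close>] by blast
  show ?thesis
  proof (rule rapidly_killedI)
    show "0 < c / \<beta>" using c \<beta> by simp
    show "0 \<le> D1 + ?C * (D2 + D2)" using D1 D2 by simp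
    fix x :: 'a and t :: real assume x: "2 * R \<le> norm x" and t: "0 < t"
    let ?l = "\<beta> powr norm x"
    have l: "0 < ?l" using \<beta> by simp
    have tri: "norm x \<le> norm y + norm (y - x)" for y
      by (metis norm_minus_commute norm_triangle_sub)
    have low: "c / \<beta> * ?l \<le> V y" if y: "norm (y - x) \<le> 1" for y
    proof -
      have ny: "norm x - 1 \<le> norm y" using tri[of y] y by simp
      then have "c * \<beta> powr (norm x - 1) \<le> c * \<beta> powr norm y" using \<beta> c by simp
      also have "\<dots> \<le> V y" using ny x R by (intro V) simp
      finally show ?thesis using \<beta> by (simp add: powr_diff)
    qed
    have low2: "c * ?l powr (1/2) \<le> V y" if y: "norm (y - x) \<le> norm x / 2" for y
    proof -
      have ny: "norm x / 2 \<le> norm y" using tri[of y] y by simp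
      then have "c * \<beta> powr (norm x / 2) \<le> c * \<beta> powr norm y" using \<beta> c by simp
      also have "\<dots> \<le> V y" using ny x by (intro V) simp
      finally show ?thesis by (simp add: powr_powr)
    qed
    define h where "h = ?l powr (- (1/4))"
    have h: "0 < h" unfolding h_def using l by simp
    have sqrt_h: "1 / sqrt h = ?l powr (1/8)"
    proof -
      have "sqrt h = h powr (1/2)" using h by (simp add: powr_half_sqrt)
      also have "\<dots> = ?l powr (- (1/8))" unfolding h_def powr_powr by simp
      finally show ?thesis by (simp add: powr_minus_divide)
    qed
    have 1: "exp (- (c * ?l powr (1/2) * h)) \<le> D1 * ?l powr (- p)"
    proof -
      have "?l powr (1/2) * h = ?l powr (1/4)" unfolding h_def powr_add[symmetric] by simp
      then have eq: "c * ?l powr (1/2) * h = c * ?l powr (1/4)" by (simp only: mult.assoc)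
      show ?thesis unfolding eq using D1(2)[of "?l powr (1/4)"] l by (simp add: powr_powr)
    qed
    have 2: "exp (- (1 / sqrt h)) \<le> D2 * ?l powr (- p)"
      unfolding sqrt_h using D2(2)[of "?l powr (1/8)"] l by (simp add: powr_powr)
    have 3: "exp (- (norm x / 2 / sqrt h)) \<le> D2 * ?l powr (- p)"
    proof -
      have "1 / sqrt h \<le> norm x / 2 / sqrt h"
        using x R h by (intro divide_right_mono) auto
      then show ?thesis using 2 by (meson exp_le_cancel_iff le_imp_neg_le order_trans)
    qed
    have "survival x t \<le> exp (- (c / \<beta> * ?l * t)) + (exp (- (c * ?l powr (1/2) * h)) + ?C *
        (exp (- (1 / sqrt h)) + exp (- (norm x / 2 / sqrt h))))"
      by (rule survival_le_two_scales[OF h t _ _ low low2]) auto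
    also have "\<dots> \<le> exp (- (c / \<beta> * ?l * t)) + (D1 * ?l powr (- p) + ?C *
        (D2 * ?l powr (- p) + D2 * ?l powr (- p)))"
      by (intro add_mono mult_left_mono order_refl 1 2 3) auto
    finally show "survival x t \<le> exp (- (c / \<beta> * ?l * t)) + (D1 + ?C * (D2 + D2)) * ?l powr (- p)"
      by (simp add: algebra_simps)
  qed
qed

end

theorem theorem3:
  fixes M :: "'w measure"
    and B :: "real \<Rightarrow> 'w \<Rightarrow> 'a::euclidean_space"
    and V :: "'a \<Rightarrow> real"
  assumes "brownian_motion M B"
    and "\<And>x. 0 \<le> V x"
    and "Linf_loc V"
    and "approx_globally V (\<lambda>_. 1) \<or>
      (\<exists>\<alpha>>0. approx_globally V (\<lambda>x. norm x powr \<alpha>)) \<or>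
      (\<exists>\<beta>>1. approx_globally V (\<lambda>x. \<beta> powr norm x))"
  shows "\<forall>a>0. riesz_bounded M B V a"
proof (intro allI impI)
  fix a :: real assume a: "0 < a"
  interpret brownian_motion M B by fact
  obtain W where W: "\<And>t. W t \<in> borel_measurable M" "\<And>\<omega>. continuous_on UNIV (\<lambda>t. W t \<omega>)"
    "AE \<omega> in M. \<forall>t\<ge>0. W t \<omega> = B t \<omega>"
    using continuous_version_exists by blast
  have reduce: "riesz_bounded M B V a"
    if g: "continuous_on UNIV g" "\<And>x. 0 \<le> g x" "\<And>x. 1 \<le> norm x \<Longrightarrow> 1 \<le> g x"
      and approx: "approx_globally V g"
      and short: "\<And>U c R. killed_brownian_motion M B W U \<Longrightarrow> 0 < c \<Longrightarrow> 1 \<le> R \<Longrightarrow>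
        (\<And>x. R \<le> norm x \<Longrightarrow> c * g x \<le> U x) \<Longrightarrow>
        killed_brownian_motion.rapidly_killed M W U g (2 * a)"
    for g
  proof -
    obtain U c C R where U: "U \<in> borel_measurable borel" "\<And>x. 0 \<le> U x"
      "\<And>r. \<exists>K. \<forall>x. norm x \<le> r \<longrightarrow> U x \<le> K" and UV: "AE x in lebesgue. V x = U x"
      and c: "0 < c" and C: "0 < C"
      and Ug: "\<And>x. R \<le> norm x \<Longrightarrow> c * g x \<le> U x \<and> U x \<le> C * g x"
      using borel_potential_exists[OF assms(2,3) g(1,2) approx] by blast
    interpret killed_brownian_motion M B W U
      by unfold_locales (use W U in auto)
    \<comment> \<open>Outside the unit ball \<open>g \<ge> 1\<close>, so that \<open>U\<close> is bounded below by \<open>c\<close>.\<close>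
    define S where "S = max R 1"
    have S: "1 \<le> S" "R \<le> S" by (auto simp: S_def)
    have low: "c * g x \<le> U x" if "S \<le> norm x" for x using Ug[of x] that S by auto
    have "c \<le> U y" if "S \<le> norm y" for y
    proof -
      have "c * 1 \<le> c * g y" using c g(3)[of y] that S by simp
      then show ?thesis using low[OF that] by simp
    qed
    from survival_exp_decay[OF c this] obtain d
      where d: "0 < d" "\<And>x t. 0 < t \<Longrightarrow> survival x t \<le> 4 * exp (- (d * t))" by blast
    have "rapidly_killed g (2 * a)"
      by (rule short[OF killed_brownian_motion_axioms c S(1) low])
    then obtain c' D R' where c': "0 < c'" "0 \<le> D"
      and sh: "\<And>x t. R' \<le> norm x \<Longrightarrow> 0 < t \<Longrightarrow>
        survival x t \<le> exp (- (c' * g x * t)) + D * g x powr (- (2 * a))"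
      unfolding rapidly_killed_def by blast
    obtain K where K: "\<And>x. ennreal (U x powr a) *
        (\<integral>\<^sup>+ t\<in>{0<..}. ennreal (survival x t * t powr (a - 1)) \<partial>lborel) \<le> ennreal K"
    proof (rule riesz_integral_bounded[OF a c'(1) C c'(2) d(1), of "max S R'" g])
      fix x :: 'a assume "max S R' \<le> norm x"
      then have x: "1 \<le> norm x" "R \<le> norm x" "R' \<le> norm x" using S by auto
      show "0 < g x" using g(3)[OF x(1)] by simp
      show "U x \<le> C * g x" using Ug[OF x(2)] by simp
      show "survival x t \<le> exp (- (c' * g x * t)) + D * g x powr (- (2 * a))" if "0 < t" for t
        by (rule sh[OF x(3) that])
    qed (use d(2) in auto)
    have "V \<in> borel_measurable lebesgue" using assms(3) by (simp add: Linf_loc_def)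
    from riesz_boundedI[OF this UV K] show ?thesis .
  qed
  have p: "0 < 2 * a" using a by simp
  from assms(4) consider "approx_globally V (\<lambda>_. 1)"
    | \<alpha> where "0 < \<alpha>" "approx_globally V (\<lambda>x. norm x powr \<alpha>)"
    | \<beta> where "1 < \<beta>" "approx_globally V (\<lambda>x. \<beta> powr norm x)" by blast
  then show "riesz_bounded M B V a"
  proof cases
    case 1
    show ?thesis
    proof (rule reduce[OF _ _ _ 1])
      fix U c R assume U: "killed_brownian_motion M B W U"
      then interpret killed_brownian_motion M B W U .
      show "rapidly_killed (\<lambda>_. 1) (2 * a)" by (rule rapidly_killed_bounded_growth)
    qed auto
  next
    case (2 \<alpha>)
    show ?thesis
    proof (rule reduce[OF _ _ _ 2(2)])
      show "continuous_on UNIV (\<lambda>x::'a. norm x powr \<alpha>)"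
        using 2(1) by (intro continuous_on_powr' continuous_intros) auto
      show "1 \<le> norm x powr \<alpha>" if "1 \<le> norm x" for x :: 'a
        using that 2(1) by (simp add: ge_one_powr_ge_zero)
      fix U c R assume U: "killed_brownian_motion M B W U" "0 < c" "1 \<le> R"
        "\<And>x::'a. R \<le> norm x \<Longrightarrow> c * norm x powr \<alpha> \<le> U x"
      from U(1) interpret killed_brownian_motion M B W U .
      show "rapidly_killed (\<lambda>x. norm x powr \<alpha>) (2 * a)"
        by (rule rapidly_killed_power_growth[OF p U(2) 2(1) U(3,4)])
    qed auto
  next
    case (3 \<beta>)
    show ?thesis
    proof (rule reduce[OF _ _ _ 3(2)])
      show "continuous_on UNIV (\<lambda>x::'a. \<beta> powr norm x)"
        using 3(1) by (intro continuous_on_powr continuous_intros) auto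
      show "1 \<le> \<beta> powr norm x" for x :: 'a
        using 3(1) by (simp add: ge_one_powr_ge_zero)
      fix U c R assume U: "killed_brownian_motion M B W U" "0 < c" "1 \<le> R"
        "\<And>x::'a. R \<le> norm x \<Longrightarrow> c * \<beta> powr norm x \<le> U x"
      from U(1) interpret killed_brownian_motion M B W U .
      show "rapidly_killed (\<lambda>x. \<beta> powr norm x) (2 * a)"
        by (rule rapidly_killed_exponential_growth[OF p U(2) 3(1) U(3,4)])
    qed auto
  qed
qed

end
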